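(* Let $\alpha,\beta,\lambda,\kappa\in\mathbb{R}$ with $\kappa\neq 0$. The singular point $Q=(0,\frac{\alpha}{\kappa},0)$ of the Hide-Skeldon-Acheson dynamo system $$\dot x=-x-\beta z+xy,\qquad \dot y=\alpha-\kappa y-\alpha x^2,\qquad \dot z=x-\lambda z$$ is never a nilpotent center on a center manifold.
   Context: A singular point of a three-dimensional analytic system is nilpotent if, after a translation and a linear change of variables, the linear part of the system at it is $\dot x=y$, $\dot y=0$, $\dot z=-\nu z$ with $\nu\neq 0$. In these coordinates a center manifold is an invariant surface $z=h(x,y)$ through the singular point tangent to the $xy$-plane there, with $h$ of class $C^r$ ($r$ any finite integer as large as needed). A nilpotent singular point is a nilpotent center on a center manifold if, for the system restricted to the center manifold, some punctured neighborhood of the point is filled with periodic orbits surrounding it. *)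

theory Defs
  imports "HOL-Analysis.Analysis"
begin

text \<open>
  \<open>f\<close> is of class \<open>C\<^sup>k\<close> on \<open>U\<close>, for \<open>U\<close> open: partial derivatives up to order \<open>k\<close> exist
  and are continuous, expressed recursively.
\<close>

fun Ck_on :: "nat \<Rightarrow> ('a::euclidean_space \<Rightarrow> real) \<Rightarrow> 'a set \<Rightarrow> bool" where
  "Ck_on 0 f U \<longleftrightarrow> continuous_on U f"
| "Ck_on (Suc k) f U \<longleftrightarrow>
     (\<forall>x\<in>U. f differentiable (at x)) \<and>
     (\<forall>b\<in>Basis. Ck_on k (\<lambda>x. frechet_derivative f (at x) b) U)"

definition solution_on :: "('a::real_normed_vector \<Rightarrow> 'a) \<Rightarrow> real set \<Rightarrow> (real \<Rightarrow> 'a) \<Rightarrow> bool" where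
  "solution_on F I \<gamma> \<longleftrightarrow> (\<forall>t\<in>I. (\<gamma> has_vector_derivative F (\<gamma> t)) (at t within I))"

definition periodic_solution :: "('a::real_normed_vector \<Rightarrow> 'a) \<Rightarrow> (real \<Rightarrow> 'a) \<Rightarrow> bool" where
  "periodic_solution F \<gamma> \<longleftrightarrow>
     solution_on F UNIV \<gamma> \<and> (\<exists>T>0. \<forall>t. \<gamma> (t + T) = \<gamma> t) \<and> \<not> \<gamma> constant_on UNIV"

text \<open>
  The vector field \<open>F\<close> in the coordinates \<open>w\<close> given by \<open>v = p + A w\<close>.
\<close>

definition field_in_coords ::
    "(real^3 \<Rightarrow> real^3) \<Rightarrow> real^3 \<Rightarrow> real^3^3 \<Rightarrow> real^3 \<Rightarrow> real^3" where
  "field_in_coords F p A w = matrix_inv A *v F (p + A *v w)"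

definition nilpotent_coords :: "(real^3 \<Rightarrow> real^3) \<Rightarrow> real^3 \<Rightarrow> real^3^3 \<Rightarrow> bool" where
  "nilpotent_coords F p A \<longleftrightarrow>
     invertible A \<and> F p = 0 \<and>
     (\<exists>\<nu>. \<nu> \<noteq> 0 \<and>
        (field_in_coords F p A has_derivative (\<lambda>w. vector [w$2, 0, - \<nu> * w$3])) (at 0))"

definition xy_part :: "real^3 \<Rightarrow> real^2" where
  "xy_part w = vector [w$1, w$2]"

definition graph_point :: "(real^2 \<Rightarrow> real) \<Rightarrow> real^2 \<Rightarrow> real^3" where
  "graph_point h q = vector [q$1, q$2, h q]"

text \<open>
  Invariance is local, as usual for center manifolds: a solution starting on the graph of \<open>h\<close>
  over \<open>U\<close> can leave it only through the boundary of \<open>U\<close>.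
\<close>

definition center_manifold ::
    "nat \<Rightarrow> (real^3 \<Rightarrow> real^3) \<Rightarrow> (real^2 \<Rightarrow> real) \<Rightarrow> (real^2) set \<Rightarrow> bool" where
  "center_manifold r G h U \<longleftrightarrow>
     open U \<and> 0 \<in> U \<and> Ck_on r h U \<and>
     h 0 = 0 \<and> (h has_derivative (\<lambda>_. 0)) (at 0) \<and>
     (\<forall>I w t0. is_interval I \<and> t0 \<in> I \<and> solution_on G I w \<and>
        w t0 \<in> graph_point h ` U \<and> (\<forall>t\<in>I. xy_part (w t) \<in> U) \<longrightarrow>
        (\<forall>t\<in>I. w t \<in> graph_point h ` U))"

text \<open>
  The system restricted to \<open>z = h(x,y)\<close>, in the coordinates \<open>(x,y)\<close> of the surface.
\<close>

definition restricted_field ::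
    "(real^3 \<Rightarrow> real^3) \<Rightarrow> (real^2 \<Rightarrow> real) \<Rightarrow> real^2 \<Rightarrow> real^2" where
  "restricted_field G h q = xy_part (G (graph_point h q))"

text \<open>
  The neighborhood \<open>V\<close> is required to lie in the domain \<open>U\<close> on which the planar field \<open>g\<close> is
  considered.  An orbit surrounds the origin if the origin lies in a bounded component of its
  complement.
\<close>

definition planar_center :: "(real^2 \<Rightarrow> real^2) \<Rightarrow> (real^2) set \<Rightarrow> bool" where
  "planar_center g U \<longleftrightarrow>
     (\<exists>V. open V \<and> 0 \<in> V \<and> V \<subseteq> U \<and>
        (\<forall>q\<in>V - {0}. \<exists>\<gamma>. periodic_solution g \<gamma> \<and> q \<in> range \<gamma> \<and>
            range \<gamma> \<subseteq> V - {0} \<and> 0 \<in> inside (range \<gamma>)))"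

definition nilpotent_center_on_center_manifold ::
    "nat \<Rightarrow> (real^3 \<Rightarrow> real^3) \<Rightarrow> real^3 \<Rightarrow> bool" where
  "nilpotent_center_on_center_manifold r F p \<longleftrightarrow>
     (\<exists>A h U. nilpotent_coords F p A \<and>
        center_manifold r (field_in_coords F p A) h U \<and>
        planar_center (restricted_field (field_in_coords F p A) h) U)"

text \<open>
  The Hide-Skeldon-Acheson dynamo vector field; \<open>l\<close> is the parameter usually written lambda.
\<close>

definition hsa_field :: "real \<Rightarrow> real \<Rightarrow> real \<Rightarrow> real \<Rightarrow> real^3 \<Rightarrow> real^3" where
  "hsa_field \<alpha> \<beta> l \<kappa> v =
     (let x = v$1; y = v$2; z = v$3 in
      vector [- x - \<beta> * z + x * y, \<alpha> - \<kappa> * y - \<alpha> * x^2, x - l * z])"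

lemma hsa_field_singular_point:
  assumes "\<kappa> \<noteq> 0"
  shows "hsa_field \<alpha> \<beta> l \<kappa> (vector [0, \<alpha> / \<kappa>, 0]) = 0"
  using assms by (simp add: hsa_field_def Let_def vec_eq_iff forall_3)

end

theory Submission
  imports Defs
begin

text \<open>
  Nilpotency forces \<open>\<beta> = l\<^sup>2\<close> and \<open>\<alpha> = \<kappa> (l + 1)\<close>.  A center on a center manifold would contain
  periodic orbits of the three-dimensional system in every neighborhood of the singular point.
  Indeed, take orbits through points tending to the origin that all leave a small disc, and follow
  each of them backward until it first meets the boundary circle.  By Gronwall this takes longer
  and longer, so the orbit of a limit of the exit points never leaves the disc in forward time and,
  being periodic, lies in it entirely.  On the other hand, for \<open>l (l + 1) \<noteq> 0\<close> there is, near the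
  singular point, a polynomial in all three variables whose derivative along the flow vanishes only
  at that point and has a constant sign elsewhere; such a function rules out small periodic orbits.  In the
  monodromic case \<open>l (l + 1) > 0\<close> it is a corrected energy of \<open>x' = v, v' = - x\<^sup>3\<close>, the leading
  part of the restricted system.  The first focal quantity is a multiple of \<open>3 \<kappa> - 2 l\<close>; when it
  vanishes the next one does not.
\<close>

section \<open>Local solutions and continuous dependence\<close>

text \<open>The Picard operator contracts distances by the factor 1/2 because
  \<open>\<tau> * L \<le> 1/2\<close>; its fixed point is the solution.\<close>

lemma global_lipschitz_solution:
  fixes H :: "'a::euclidean_space \<Rightarrow> 'a"
  assumes L: "L-lipschitz_on UNIV H" and \<tau>: "0 \<le> \<tau>" "\<tau> * L \<le> 1/2"
  shows "\<exists>w. w 0 = x0 \<and> solution_on H {0..\<tau>} w"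
proof -
  \<comment> \<open>The contraction acts on bounded continuous functions on the whole line, so time
    outside \<open>{0..\<tau>}\<close> is frozen at the nearer endpoint.\<close>
  define c where "c t = max 0 (min t \<tau>)" for t :: real
  have c_in: "c t \<in> {0..\<tau>}" for t using \<tau> by (auto simp: c_def)
  have c_id: "c t = t" if "t \<in> {0..\<tau>}" for t using that by (auto simp: c_def)
  have c_cont: "continuous_on UNIV c" unfolding c_def by (intro continuous_intros)
  have contH: "continuous_on UNIV H" by (rule lipschitz_on_continuous_on[OF L])
  have contHf: "continuous_on S (\<lambda>s. H (f s))" if "continuous_on S f" for f :: "real \<Rightarrow> 'a" and S
    by (rule continuous_on_compose2[OF contH that]) auto
  define J where "J f t = x0 + integral {0..t} (\<lambda>s. H (apply_bcontfun f s))"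
    for f :: "real \<Rightarrow>\<^sub>C 'a" and t
  have J_deriv: "(J f has_vector_derivative H (f t)) (at t within {0..\<tau>})"
    if "t \<in> {0..\<tau>}" for f t
    unfolding J_def
    using has_vector_derivative_add[OF has_vector_derivative_const
        integral_has_vector_derivative[OF contHf[OF continuous_on_apply_bcontfun] that]] by simp
  have J_cont: "continuous_on {0..\<tau>} (J f)" for f
    by (rule continuous_on_vector_derivative[OF J_deriv])
  have bc: "(\<lambda>t. J f (c t)) \<in> bcontfun" for f
  proof -
    have "continuous_on UNIV (\<lambda>t. J f (c t))"
      by (rule continuous_on_compose2[OF J_cont c_cont]) (use c_in in blast)
    moreover have "bounded (J f ` {0..\<tau>})"
      by (intro compact_imp_bounded compact_continuous_image J_cont) simp
    then obtain b where "\<forall>y\<in>J f ` {0..\<tau>}. norm y \<le> b"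
      unfolding bounded_iff by blast
    ultimately show ?thesis using c_in by (intro bcontfun_normI) auto
  qed
  define T where "T f = Bcontfun (\<lambda>t. J f (c t))" for f
  have T: "apply_bcontfun (T f) t = J f (c t)" for f t
    unfolding T_def using bc by (simp add: Bcontfun_inverse)
  have "dist (T f) (T g) \<le> 1/2 * dist f g" for f g
  proof (rule dist_bound)
    fix t
    have *: "(\<lambda>s. H (f s)) integrable_on {0..c t}" for f :: "real \<Rightarrow>\<^sub>C 'a"
      by (intro integrable_continuous_real contHf) auto
    have "dist (T f t) (T g t) = norm (integral {0..c t} (\<lambda>s. H (f s) - H (g s)))"
      by (simp add: T J_def dist_norm integral_diff[OF * *])
    also have "\<dots> \<le> (L * dist f g) * (c t - 0)"
    proof (rule integral_bound)
      fix s
      have "dist (H (f s)) (H (g s)) \<le> L * dist (f s) (g s)"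
        using L by (simp add: lipschitz_on_def)
      also have "\<dots> \<le> L * dist f g"
        using lipschitz_on_nonneg[OF L] by (intro mult_left_mono dist_bounded)
      finally show "norm (H (f s) - H (g s)) \<le> L * dist f g" by (simp add: dist_norm)
    qed (use c_in[of t] in \<open>auto intro!: continuous_intros contHf\<close>)
    also have "\<dots> \<le> (L * dist f g) * \<tau>"
      using c_in[of t] lipschitz_on_nonneg[OF L] by (intro mult_left_mono) auto
    also have "\<dots> = (\<tau> * L) * dist f g" by simp
    also have "\<dots> \<le> 1/2 * dist f g" using \<tau> by (intro mult_right_mono) auto
    finally show "dist (T f t) (T g t) \<le> 1/2 * dist f g" .
  qed
  then obtain f where f: "T f = f"
    using banach_fix_type[of "1/2" T] by auto
  have eq: "f t = J f t" if "t \<in> {0..\<tau>}" for t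
    using T[of f t] c_id[OF that] f by simp
  have "f 0 = x0" using eq[of 0] \<tau> by (simp add: J_def)
  moreover have "(f has_vector_derivative H (f t)) (at t within {0..\<tau>})" if "t \<in> {0..\<tau>}" for t
    using has_vector_derivative_transform[OF that _ J_deriv[OF that]] eq by simp
  ultimately show ?thesis unfolding solution_on_def by blast
qed

text \<open>Composing \<open>G\<close> with the closest-point projection to the ball, which does not
  increase distances, gives a globally Lipschitz field. By continuity its solution stays in the ball
  for a short time and solves the original equation there.\<close>

lemma local_solution_exists:
  fixes G :: "'a::euclidean_space \<Rightarrow> 'a"
  assumes L: "L-lipschitz_on (cball x0 1) G"
  shows "\<exists>\<tau>>0. \<exists>w. w 0 = x0 \<and> solution_on G {0..\<tau>} w"
proof -
  define P where "P = closest_point (cball x0 1)"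
  have P_in: "P x \<in> cball x0 1" for x unfolding P_def by (intro closest_point_in_set) auto
  have P_id: "P x = x" if "x \<in> cball x0 1" for x
    unfolding P_def by (rule closest_point_self[OF that])
  have L0: "0 \<le> L" by (rule lipschitz_on_nonneg[OF L])
  have "L-lipschitz_on UNIV (\<lambda>x. G (P x))"
  proof (rule lipschitz_onI)
    fix x y
    have "dist (G (P x)) (G (P y)) \<le> L * dist (P x) (P y)"
      using L P_in by (simp add: lipschitz_on_def)
    also have "\<dots> \<le> L * dist x y"
      unfolding P_def using L0 by (intro mult_left_mono closest_point_lipschitz) auto
    finally show "dist (G (P x)) (G (P y)) \<le> L * dist x y" .
  qed (rule L0)
  \<comment> \<open>The summand 1 avoids a division by zero when \<open>L = 0\<close>.\<close>
  moreover define \<tau> where "\<tau> = 1 / (2 * (L + 1))"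
  have "\<tau> > 0" "\<tau> * L \<le> 1/2" using L0 by (auto simp: \<tau>_def field_simps)
  ultimately obtain w where w: "w 0 = x0" "solution_on (\<lambda>x. G (P x)) {0..\<tau>} w"
    using global_lipschitz_solution[of L "\<lambda>x. G (P x)" \<tau> x0] by auto
  have "continuous_on {0..\<tau>} w"
    using w(2) unfolding solution_on_def by (intro continuous_on_vector_derivative) blast
  moreover have "0 \<in> {0..\<tau>}" using \<open>\<tau> > 0\<close> by simp
  ultimately obtain d where d: "d > 0" "\<And>t. t \<in> {0..\<tau>} \<Longrightarrow> dist t 0 < d \<Longrightarrow> dist (w t) (w 0) < 1"
    unfolding continuous_on_iff using zero_less_one by blast
  define \<sigma> where "\<sigma> = min \<tau> (d/2)"
  have "\<sigma> > 0" using d \<open>\<tau> > 0\<close> by (simp add: \<sigma>_def)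
  moreover have "solution_on G {0..\<sigma>} w"
    unfolding solution_on_def
  proof
    fix t assume t: "t \<in> {0..\<sigma>}"
    then have t': "t \<in> {0..\<tau>}" "dist t 0 < d" using \<open>d > 0\<close> by (auto simp: \<sigma>_def)
    have "w t \<in> cball x0 1" using d(2)[OF t'] w(1) by (simp add: dist_commute less_imp_le)
    moreover have "(w has_vector_derivative G (P (w t))) (at t within {0..\<tau>})"
      using w(2) t' by (simp add: solution_on_def)
    ultimately have "(w has_vector_derivative G (w t)) (at t within {0..\<tau>})"
      using P_id by simp
    then show "(w has_vector_derivative G (w t)) (at t within {0..\<sigma>})"
      by (rule has_vector_derivative_within_subset) (auto simp: \<sigma>_def)
  qed
  ultimately show ?thesis using w(1) by blast
qed

text \<open>The squared distance times \<open>exp (- 2 * L * t)\<close> has nonpositive derivative.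
  The square is differentiable even where the distance vanishes.\<close>

lemma solutions_gronwall:
  fixes G :: "'a::euclidean_space \<Rightarrow> 'a"
  assumes L: "L-lipschitz_on K G" and "a \<le> b"
    and u: "\<And>t. t \<in> {a..b} \<Longrightarrow> (u has_vector_derivative G (u t)) (at t)" "u ` {a..b} \<subseteq> K"
    and v: "\<And>t. t \<in> {a..b} \<Longrightarrow> (v has_vector_derivative G (v t)) (at t)" "v ` {a..b} \<subseteq> K"
  shows "norm (u b - v b) \<le> norm (u a - v a) * exp (L * (b - a))"
proof -
  define n where "n t = (u t - v t) \<bullet> (u t - v t)" for t
  define \<phi> where "\<phi> t = exp (- 2 * L * t) * n t" for t
  have "\<phi> b \<le> \<phi> a"
  proof (rule DERIV_nonpos_imp_nonincreasing[OF \<open>a \<le> b\<close>])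
    fix t assume t: "a \<le> t" "t \<le> b"
    let ?d = "u t - v t" and ?D = "G (u t) - G (v t)"
    have "((\<lambda>t. u t - v t) has_vector_derivative ?D) (at t)"
      using u v t by (auto intro!: derivative_intros)
    then have der: "((\<lambda>t. u t - v t) has_derivative (\<lambda>h. h *\<^sub>R ?D)) (at t)"
      by (simp add: has_vector_derivative_def)
    have "((\<lambda>t. (u t - v t) \<bullet> (u t - v t)) has_derivative (\<lambda>h. ?d \<bullet> (h *\<^sub>R ?D) + (h *\<^sub>R ?D) \<bullet> ?d)) (at t)"
      by (rule has_derivative_inner[OF der der])
    then have "(n has_real_derivative 2 * (?d \<bullet> ?D)) (at t)"
      unfolding n_def by (rule has_derivative_imp_has_field_derivative) (simp add: inner_commute algebra_simps)
    then have "(\<phi> has_real_derivative exp (- 2 * L * t) * (2 * (?d \<bullet> ?D) - 2 * L * n t)) (at t)"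
      unfolding \<phi>_def by (auto intro!: derivative_eq_intros simp: algebra_simps)
    moreover have "?d \<bullet> ?D \<le> norm ?d * norm ?D" by (rule norm_cauchy_schwarz)
    moreover have "norm ?d * norm ?D \<le> norm ?d * (L * norm ?d)"
      using L u(2) v(2) t by (intro mult_left_mono) (auto simp: lipschitz_on_def dist_norm image_subset_iff)
    moreover have "norm ?d * (L * norm ?d) = L * n t"
      by (simp add: n_def power2_norm_eq_inner[symmetric] power2_eq_square)
    ultimately show "\<exists>y. (\<phi> has_real_derivative y) (at t) \<and> y \<le> 0"
      by (intro exI[of _ "exp (- 2 * L * t) * (2 * (?d \<bullet> ?D) - 2 * L * n t)"])
         (auto intro!: mult_nonneg_nonpos)
  qed
  then have "exp (2 * L * b) * \<phi> b \<le> exp (2 * L * b) * \<phi> a" by simp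
  moreover have "exp (2 * L * b) * \<phi> t = exp (2 * (L * (b - t))) * norm (u t - v t)^2" for t
    by (simp add: \<phi>_def n_def power2_norm_eq_inner mult.assoc[symmetric] exp_add[symmetric]) (simp add: algebra_simps)
  ultimately have "norm (u b - v b)^2 \<le> exp (2 * (L * (b - a))) * norm (u a - v a)^2" by simp
  also have "\<dots> = (norm (u a - v a) * exp (L * (b - a)))^2"
    unfolding exp_double power_mult_distrib by (rule mult.commute)
  finally show ?thesis by (rule power2_le_imp_le) simp
qed

text \<open>After time reversal both curves solve the equation of \<open>- G\<close>, which has the
  same Lipschitz constant.\<close>

lemma solutions_gronwall_backward:
  fixes G :: "'a::euclidean_space \<Rightarrow> 'a"
  assumes L: "L-lipschitz_on K G" and "a \<le> b"
    and u: "\<And>t. t \<in> {a..b} \<Longrightarrow> (u has_vector_derivative G (u t)) (at t)" "u ` {a..b} \<subseteq> K"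
    and v: "\<And>t. t \<in> {a..b} \<Longrightarrow> (v has_vector_derivative G (v t)) (at t)" "v ` {a..b} \<subseteq> K"
  shows "norm (u a - v a) \<le> norm (u b - v b) * exp (L * (b - a))"
proof -
  have rev: "((\<lambda>s. f (- s)) has_vector_derivative - G (f (- t))) (at t)"
    if "(f has_vector_derivative G (f (- t))) (at (- t))" for f and t :: real
  proof -
    have "(uminus has_vector_derivative - 1) (at t)" by (auto intro!: derivative_eq_intros)
    from vector_diff_chain_at[OF this that] show ?thesis by (simp add: o_def)
  qed
  have "norm (u (- (- a)) - v (- (- a))) \<le> norm (u (- (- b)) - v (- (- b))) * exp (L * (- a - (- b)))"
    by (rule solutions_gronwall[where G = "\<lambda>x. - G x" and K = K and u = "\<lambda>s. u (- s)" and v = "\<lambda>s. v (- s)"])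
      (use \<open>a \<le> b\<close> u v L in \<open>auto intro!: rev lipschitz_on_minus[OF L]\<close>)
  then show ?thesis by simp
qed

section \<open>Time shifts and periodic solutions\<close>

lemma solution_shift:
  assumes "solution_on F UNIV \<gamma>"
  shows "solution_on F UNIV (\<lambda>t. \<gamma> (t + s))"
  unfolding solution_on_def
proof
  fix t
  have "((\<lambda>t. t + s) has_vector_derivative 1) (at t)" by (auto intro!: derivative_eq_intros)
  moreover have "(\<gamma> has_vector_derivative F (\<gamma> (t + s))) (at (t + s))"
    using assms by (simp add: solution_on_def)
  ultimately show "((\<lambda>t. \<gamma> (t + s)) has_vector_derivative F (\<gamma> (t + s))) (at t)"
    using vector_diff_chain_at[of "\<lambda>t. t + s" 1 t \<gamma>] by (simp add: o_def)
qed

lemma solution_continuous: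
  assumes "solution_on F I \<gamma>"
  shows "continuous_on I \<gamma>"
  using assms unfolding solution_on_def by (intro continuous_on_vector_derivative) blast

lemma periodic_solution_shift:
  assumes "periodic_solution F \<gamma>"
  shows "periodic_solution F (\<lambda>t. \<gamma> (t + s))"
proof -
  obtain T where T: "T > 0" "\<And>t. \<gamma> (t + T) = \<gamma> t"
    using assms by (auto simp: periodic_solution_def)
  have "\<gamma> (t + T + s) = \<gamma> (t + s)" for t using T(2)[of "t + s"] by (simp add: ac_simps)
  moreover have "\<not> (\<lambda>t. \<gamma> (t + s)) constant_on UNIV"
  proof
    assume "(\<lambda>t. \<gamma> (t + s)) constant_on UNIV"
    then obtain c where "\<And>t. \<gamma> (t + s) = c" by (auto simp: constant_on_def)
    then have "\<gamma> t = c" for t by (metis diff_add_cancel)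
    then show False using assms by (auto simp: periodic_solution_def constant_on_def)
  qed
  ultimately show ?thesis
    using assms T(1) solution_shift unfolding periodic_solution_def by blast
qed

lemma periodic_add_multiple:
  fixes f :: "real \<Rightarrow> 'a"
  assumes "\<And>t. f (t + T) = f t"
  shows "f (t + real n * T) = f t"
proof (induction n)
  case (Suc n)
  have "f (t + real (Suc n) * T) = f (t + real n * T + T)" by (simp add: algebra_simps)
  then show ?case using assms Suc by simp
qed simp

lemma periodic_attained_later:
  fixes f :: "real \<Rightarrow> 'a"
  assumes "T > 0" "\<And>t. f (t + T) = f t"
  obtains s where "s > a" "f s = f t"
proof -
  obtain n :: nat where "real n > (a - t) / T" using reals_Archimedean2 by blast
  then have "t + real n * T > a" using \<open>T > 0\<close> by (simp add: field_simps)
  then show ?thesis using that periodic_add_multiple[of f T t n] assms by blast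
qed

lemma periodic_attained_earlier:
  fixes f :: "real \<Rightarrow> 'a"
  assumes "T > 0" "\<And>t. f (t + T) = f t"
  obtains s where "s < a" "f s = f t"
proof -
  have "f (- (s + T)) = f (- s)" for s using assms(2)[of "- (s + T)"] by simp
  then obtain s where "s > - a" "f (- s) = f (- (- t))"
    using periodic_attained_later[of T "\<lambda>s. f (- s)" "- a" "- t"] assms(1) by blast
  then show ?thesis using that[of "- s"] by simp
qed

lemma periodic_solution_bounded:
  assumes "periodic_solution F \<gamma>"
  shows "bounded (range \<gamma>)"
proof -
  obtain T where T: "T > 0" "\<And>t. \<gamma> (t + T) = \<gamma> t"
    using assms by (auto simp: periodic_solution_def)
  have "\<gamma> t \<in> \<gamma> ` {0..T}" for t
  proof -
    define n where "n = \<lfloor>t / T\<rfloor>"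
    have t: "0 \<le> t - of_int n * T" "t - of_int n * T \<le> T"
      using T(1) floor_divide_lower[of T t] floor_divide_upper[of T t]
      by (auto simp: n_def algebra_simps)
    have "\<gamma> (t - of_int n * T) = \<gamma> t"
    proof (cases "n \<ge> 0")
      case True
      then show ?thesis
        using periodic_add_multiple[of \<gamma> T "t - of_int n * T" "nat n"] T(2) by simp
    next
      case False
      then show ?thesis
        using periodic_add_multiple[of \<gamma> T t "nat (- n)"] T(2) by simp
    qed
    then show ?thesis using t by (metis atLeastAtMost_iff imageI)
  qed
  moreover have "continuous_on {0..T} \<gamma>"
    using assms solution_continuous continuous_on_subset unfolding periodic_solution_def by blast
  then have "bounded (\<gamma> ` {0..T})"
    by (intro compact_imp_bounded compact_continuous_image) auto
  ultimately show ?thesis by (meson bounded_subset image_subsetI)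
qed

text \<open>Compactness gives a least time in \<open>{0..S}\<close> with \<open>f \<ge> c\<close>.
  By the intermediate value theorem the value \<open>c\<close> is taken no later than this, hence
  exactly then.\<close>

lemma first_hit:
  fixes f :: "real \<Rightarrow> real"
  assumes f: "continuous_on UNIV f" and "S > 0" "f 0 \<le> c" "c < f S"
  obtains \<tau> where "\<tau> \<ge> 0" "f \<tau> = c" "\<And>s. s \<in> {0..\<tau>} \<Longrightarrow> f s \<le> c"
proof -
  let ?A = "{0..S} \<inter> {s. c \<le> f s}"
  have "closed {s. c \<le> f s}" using f by (intro closed_Collect_le continuous_intros)
  then have "compact ?A" by (rule compact_Int_closed[OF compact_Icc])
  moreover have "S \<in> ?A" using assms by auto
  ultimately obtain \<tau> where \<tau>: "\<tau> \<in> ?A" "\<And>s. s \<in> ?A \<Longrightarrow> \<tau> \<le> s"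
    using compact_attains_inf[of ?A] by blast
  obtain s where s: "0 \<le> s" "s \<le> \<tau>" "f s = c"
    using IVT'[of f 0 c \<tau>] \<tau>(1) assms(3) continuous_on_subset[OF f] by auto
  then have "s = \<tau>" using \<tau> by fastforce
  then have "f \<tau> = c" using s by simp
  moreover have "f s \<le> c" if "s \<in> {0..\<tau>}" for s
  proof (rule ccontr)
    assume "\<not> f s \<le> c"
    then have "s \<in> ?A" using that \<tau>(1) by auto
    then have "s = \<tau>" using \<tau>(2) that by fastforce
    then show False using \<open>f \<tau> = c\<close> \<open>\<not> f s \<le> c\<close> by simp
  qed
  ultimately show ?thesis using that \<tau>(1) by auto
qed

section \<open>Solutions on a center manifold\<close>

lemma xy_part_graph_point [simp]: "xy_part (graph_point h q) = q"
  by (simp add: xy_part_def graph_point_def vec_eq_iff forall_2)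

lemma norm_xy_part_le: "norm (xy_part w) \<le> norm w"
proof (rule power2_le_imp_le)
  show "(norm (xy_part w))\<^sup>2 \<le> (norm w)\<^sup>2"
    by (simp add: power2_norm_eq_inner inner_vec_def sum_2 sum_3 xy_part_def)
qed simp

lemma bounded_linear_xy_part: "bounded_linear xy_part"
  by (rule bounded_linear_intro[where K = 1])
     (simp_all add: norm_xy_part_le, simp_all add: xy_part_def vec_eq_iff forall_2)

text \<open>In this form the derivative and continuity rules for sums and scalar multiples
  apply.\<close>

lemma vector_3_scaleR_axis:
  fixes a b c :: real
  shows "(vector [a, b, c] :: real^3) = a *\<^sub>R axis 1 1 + b *\<^sub>R axis 2 1 + c *\<^sub>R axis 3 1"
  by (simp add: vec_eq_iff forall_3 axis_def)

lemma has_vector_derivative_vector_3: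
  assumes "(f has_vector_derivative f') (at t within S)" "(g has_vector_derivative g') (at t within S)"
    "(h has_vector_derivative h') (at t within S)"
  shows "((\<lambda>t. vector [f t, g t, h t] :: real^3) has_vector_derivative vector [f', g', h']) (at t within S)"
proof -
  have "((\<lambda>t. F t *\<^sub>R (b :: real^3)) has_vector_derivative F' *\<^sub>R b) (at t within S)"
    if "(F has_vector_derivative F') (at t within S)" for F F' b
    using bounded_linear.has_vector_derivative[OF bounded_linear_scaleR_left that] .
  then show ?thesis
    unfolding vector_3_scaleR_axis using assms by (intro has_vector_derivative_add)
qed

lemma has_vector_derivative_nth:
  fixes f :: "real \<Rightarrow> real ^ 'n"
  assumes "(f has_vector_derivative f') (at t within S)"
  shows "((\<lambda>t. f t $ i) has_vector_derivative f' $ i) (at t within S)"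
  by (rule bounded_linear.has_vector_derivative[OF bounded_linear_vec_nth assms])

lemma center_manifold_has_derivative:
  assumes "center_manifold r G h U" "r \<ge> 1" "q \<in> U"
  shows "(h has_derivative frechet_derivative h (at q)) (at q)"
proof -
  obtain k where "r = Suc k" using \<open>r \<ge> 1\<close> by (cases r) auto
  then show ?thesis
    using assms by (simp add: center_manifold_def frechet_derivative_works)
qed

text \<open>A solution of \<open>G\<close> starting at the graph point stays on the graph for a
  short time. Its third component then has two expressions for the right derivative at time 0, one
  from \<open>G\<close> and one from the chain rule for \<open>h\<close>, and these agree.\<close>

lemma center_manifold_invariance_equation:
  assumes cm: "center_manifold r G h U" and r: "r \<ge> 1" and q: "q \<in> U"
    and L: "L-lipschitz_on (cball (graph_point h q) 1) G"
  shows "frechet_derivative h (at q) (restricted_field G h q) = G (graph_point h q) $ 3"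
proof -
  obtain \<tau> w where \<tau>: "\<tau> > 0" and w0: "w 0 = graph_point h q" and w: "solution_on G {0..\<tau>} w"
    using local_solution_exists[OF L] by blast
  have "continuous_on {0..\<tau>} (\<lambda>t. xy_part (w t))"
    by (rule bounded_linear.continuous_on[OF bounded_linear_xy_part solution_continuous[OF w]])
  moreover have "0 \<in> {0..\<tau>}" "xy_part (w 0) \<in> U" using \<tau> w0 q by auto
  moreover have "open U" using cm by (simp add: center_manifold_def)
  ultimately obtain e where e: "e > 0" "\<And>t. t \<in> {0..\<tau>} \<Longrightarrow> dist t 0 < e \<Longrightarrow> xy_part (w t) \<in> U"
    unfolding continuous_on_iff open_dist by metis
  define \<sigma> where "\<sigma> = min \<tau> (e / 2)"
  have \<sigma>: "\<sigma> > 0" "\<sigma> \<le> \<tau>" "\<sigma> < e" using \<tau> e(1) by (auto simp: \<sigma>_def)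
  have sol: "(w has_vector_derivative G (w t)) (at t within {0..\<sigma>})" if "t \<in> {0..\<sigma>}" for t
  proof (rule has_vector_derivative_within_subset)
    show "(w has_vector_derivative G (w t)) (at t within {0..\<tau>})"
      using w that \<sigma>(2) by (simp add: solution_on_def)
  qed (use \<sigma>(2) in simp)
  have xyU: "\<forall>t\<in>{0..\<sigma>}. xy_part (w t) \<in> U" using \<sigma> e by auto
  have on: "\<forall>t\<in>{0..\<sigma>}. w t \<in> graph_point h ` U"
  proof -
    have "is_interval {0..\<sigma>} \<and> 0 \<in> {0..\<sigma>} \<and> solution_on G {0..\<sigma>} w \<and>
        w 0 \<in> graph_point h ` U \<and> (\<forall>t\<in>{0..\<sigma>}. xy_part (w t) \<in> U)"
      using \<sigma> sol xyU w0 q by (auto simp: solution_on_def is_interval_cc)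
    then show ?thesis using cm unfolding center_manifold_def by blast
  qed
  have on_graph: "w t $ 3 = h (xy_part (w t))" if "t \<in> {0..\<sigma>}" for t
  proof -
    have "w t \<in> graph_point h ` U" using on that by blast
    then obtain p where p: "w t = graph_point h p" by (rule imageE)
    have "xy_part (w t) = p" "w t $ 3 = h p" by (simp_all only: p xy_part_graph_point) (simp add: graph_point_def)
    then show ?thesis by simp
  qed
  have z: "0 \<in> {0..\<sigma>}" using \<sigma> by simp
  have box: "{0..\<sigma>} = cbox 0 \<sigma>" by (rule cbox_interval[symmetric])
  have d1: "((\<lambda>t. w t $ 3) has_vector_derivative G (w 0) $ 3) (at 0 within {0..\<sigma>})"
    by (rule has_vector_derivative_nth[OF sol[OF z]])
  have d2: "((\<lambda>t. w t $ 3) has_vector_derivative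
      frechet_derivative h (at q) (xy_part (G (w 0)))) (at 0 within {0..\<sigma>})"
  proof -
    have xy: "((\<lambda>t. xy_part (w t)) has_vector_derivative xy_part (G (w 0))) (at 0 within {0..\<sigma>})"
      by (rule bounded_linear.has_vector_derivative[OF bounded_linear_xy_part sol[OF z]])
    have "(h has_derivative frechet_derivative h (at q)) (at (xy_part (w 0)) within (\<lambda>t. xy_part (w t)) ` {0..\<sigma>})"
      using center_manifold_has_derivative[OF cm r q] w0 by (simp add: has_derivative_at_withinI)
    from vector_derivative_diff_chain_within[OF xy this]
    have "((\<lambda>t. h (xy_part (w t))) has_vector_derivative
        frechet_derivative h (at q) (xy_part (G (w 0)))) (at 0 within {0..\<sigma>})"
      by (simp add: o_def)
    then show ?thesis
      using has_vector_derivative_transform[OF z, of "\<lambda>t. w t $ 3" "\<lambda>t. h (xy_part (w t))"] on_graph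
      by blast
  qed
  have "G (w 0) $ 3 = frechet_derivative h (at q) (xy_part (G (w 0)))"
    by (rule vector_derivative_unique_within_closed_interval[OF \<sigma>(1) z[unfolded box]
          d1[unfolded box] d2[unfolded box]])
  then show ?thesis by (simp add: w0 restricted_field_def)
qed

text \<open>The first two components are right by definition of the restricted field; the third is
  right by the invariance equation.\<close>

lemma restricted_solution_lifts:
  assumes cm: "center_manifold r G h U" and r: "r \<ge> 1"
    and lip: "\<And>q. q \<in> U \<Longrightarrow> \<exists>L. L-lipschitz_on (cball (graph_point h q) 1) G"
    and \<gamma>: "solution_on (restricted_field G h) UNIV \<gamma>" "range \<gamma> \<subseteq> U"
  shows "solution_on G UNIV (\<lambda>t. graph_point h (\<gamma> t))"
  unfolding solution_on_def
proof
  fix t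
  let ?q = "\<gamma> t"
  have q: "?q \<in> U" using \<gamma>(2) by auto
  have d: "(\<gamma> has_vector_derivative restricted_field G h ?q) (at t)"
    using \<gamma>(1) by (simp add: solution_on_def)
  have "((\<lambda>s. h (\<gamma> s)) has_vector_derivative frechet_derivative h (at ?q) (restricted_field G h ?q)) (at t)"
    using vector_derivative_diff_chain_within[of \<gamma> _ t UNIV h, OF d]
      center_manifold_has_derivative[OF cm r q] by (simp add: o_def has_derivative_at_withinI)
  then have h: "((\<lambda>s. h (\<gamma> s)) has_vector_derivative G (graph_point h ?q) $ 3) (at t)"
    using center_manifold_invariance_equation[OF cm r q] lip[OF q] by auto
  have "((\<lambda>s. graph_point h (\<gamma> s)) has_vector_derivative
      vector [restricted_field G h ?q $ 1, restricted_field G h ?q $ 2, G (graph_point h ?q) $ 3]) (at t)"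
    unfolding graph_point_def
    by (intro has_vector_derivative_vector_3 has_vector_derivative_nth d h[unfolded graph_point_def])
  moreover have "vector [restricted_field G h ?q $ 1, restricted_field G h ?q $ 2, G (graph_point h ?q) $ 3]
      = G (graph_point h ?q)"
    by (simp add: restricted_field_def xy_part_def vec_eq_iff forall_3)
  ultimately show "((\<lambda>s. graph_point h (\<gamma> s)) has_vector_derivative G (graph_point h ?q)) (at t)" by simp
qed

lemma continuous_on_graph_point:
  assumes "continuous_on S h"
  shows "continuous_on S (graph_point h)"
  unfolding graph_point_def[abs_def] vector_3_scaleR_axis by (intro continuous_intros assms)

text \<open>A center provides a periodic orbit through each nearby point but no bound on its size.
  Smallness comes from a limit argument; the Gronwall estimates are applied to the lifted orbits in
  space, where \<open>G\<close> is Lipschitz on balls.\<close>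

lemma center_manifold_small_periodic:
  assumes cm: "center_manifold r G h U" and r: "r \<ge> 1" and G0: "G 0 = 0"
    and lip: "\<And>R. \<exists>L. L-lipschitz_on (cball 0 R) G"
    and pc: "planar_center (restricted_field G h) U" and \<epsilon>: "\<epsilon> > 0"
  shows "\<exists>w. periodic_solution G w \<and> range w \<subseteq> ball 0 \<epsilon>"
proof -
  let ?g = "restricted_field G h"
  let ?P = "graph_point h"
  have "continuous_on U h"
  proof (intro continuous_at_imp_continuous_on ballI)
    show "isCont h q" if "q \<in> U" for q
      by (rule has_derivative_continuous[OF center_manifold_has_derivative[OF cm r that]])
  qed
  then have contP: "continuous_on U ?P" by (rule continuous_on_graph_point)
  have "open U" and "h 0 = 0" using cm unfolding center_manifold_def by blast+
  have P0: "?P 0 = 0"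
    unfolding graph_point_def vector_3_scaleR_axis zero_index \<open>h 0 = 0\<close> scaleR_zero_left add_0_left ..
  obtain V where V: "open V" "0 \<in> V" "V \<subseteq> U"
    and orbits: "\<forall>q\<in>V - {0}. \<exists>\<gamma>. periodic_solution ?g \<gamma> \<and> q \<in> range \<gamma> \<and>
      range \<gamma> \<subseteq> V - {0} \<and> 0 \<in> inside (range \<gamma>)"
    using pc unfolding planar_center_def by (elim exE conjE) (rule that)
  \<comment> \<open>Each orbit is shifted in time so that it passes through its base point at time
    0.\<close>
  have "\<exists>\<gamma>. periodic_solution ?g \<gamma> \<and> \<gamma> 0 = q \<and> range \<gamma> \<subseteq> V" if qV: "q \<in> V - {0}" for q
  proof -
    obtain \<gamma> s where \<gamma>: "periodic_solution ?g \<gamma>" "q = \<gamma> s" "range \<gamma> \<subseteq> V - {0}"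
      using bspec[OF orbits qV] by (elim exE conjE rangeE) (rule that)
    then show ?thesis
      by (intro exI[of _ "\<lambda>t. \<gamma> (t + s)"]) (auto intro: periodic_solution_shift)
  qed
  then obtain \<Gamma> where \<Gamma>: "\<And>q. q \<in> V - {0} \<Longrightarrow> periodic_solution ?g (\<Gamma> q)"
    "\<And>q. q \<in> V - {0} \<Longrightarrow> \<Gamma> q 0 = q" "\<And>q. q \<in> V - {0} \<Longrightarrow> range (\<Gamma> q) \<subseteq> V"
    by metis
  have cont\<Gamma>: "continuous_on UNIV (\<Gamma> q)" if "q \<in> V - {0}" for q
    using \<Gamma>(1)[OF that] solution_continuous by (auto simp: periodic_solution_def)
  have lip1: "\<exists>L. L-lipschitz_on (cball x 1) G" for x
  proof -
    have "cball x 1 \<subseteq> cball 0 (norm x + 1)"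
    proof
      fix y assume "y \<in> cball x 1"
      then have "norm (y - x) \<le> 1" by (simp add: dist_norm norm_minus_commute)
      then show "y \<in> cball 0 (norm x + 1)" using norm_triangle_sub[of y x] by simp
    qed
    then show ?thesis using lip[of "norm x + 1"] lipschitz_on_subset by blast
  qed
  have lift: "solution_on G UNIV (\<lambda>t. ?P (\<Gamma> q t))" if "q \<in> V - {0}" for q
    by (rule restricted_solution_lifts[OF cm r lip1])
       (use \<Gamma>[OF that] V(3) in \<open>auto simp: periodic_solution_def\<close>)
  have liftp: "periodic_solution G (\<lambda>t. ?P (\<Gamma> q t))" if "q \<in> V - {0}" for q
  proof -
    have "\<not> (\<lambda>t. ?P (\<Gamma> q t)) constant_on UNIV"
    proof
      assume "(\<lambda>t. ?P (\<Gamma> q t)) constant_on UNIV"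
      then obtain c where "\<And>t. ?P (\<Gamma> q t) = c" by (auto simp: constant_on_def)
      then have "\<Gamma> q t = xy_part c" for t by (metis xy_part_graph_point)
      then show False using \<Gamma>(1)[OF that] by (auto simp: periodic_solution_def constant_on_def)
    qed
    moreover have "\<exists>T>0. \<forall>t. ?P (\<Gamma> q (t + T)) = ?P (\<Gamma> q t)"
      using \<Gamma>(1)[OF that] unfolding periodic_solution_def by metis
    ultimately show ?thesis using lift[OF that] by (simp add: periodic_solution_def)
  qed
  have "isCont ?P 0"
    using contP V \<open>open U\<close> by (auto simp: continuous_on_eq_continuous_at)
  then obtain d where d: "d > 0" "\<And>q. norm q < d \<Longrightarrow> norm (?P q) < \<epsilon>"
    using \<epsilon> P0 unfolding continuous_at_eps_delta dist_norm by fastforce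
  obtain e where e: "e > 0" "ball 0 e \<subseteq> V" using V open_contains_ball by blast
  \<comment> \<open>The closed disc of radius \<open>\<rho>\<close> lies in \<open>V\<close>, and
    its lift to the graph lies in the ball of radius \<open>\<epsilon>\<close>.\<close>
  define \<rho> where "\<rho> = min d e / 2"
  have \<rho>: "\<rho> > 0" "\<rho> < d" "\<rho> < e" using d(1) e(1) by (auto simp: \<rho>_def)
  have \<rho>V: "q \<in> V" if "norm q \<le> \<rho>" for q
    using that \<rho> e(2) by (auto simp: subset_iff)
  have P\<epsilon>: "norm (?P q) < \<epsilon>" if "norm q \<le> \<rho>" for q using that d(2) \<rho> by simp
  \<comment> \<open>Either some orbit stays in the closed disc, and its lift is the one sought, or
    the orbit of every nonzero point of the disc leaves it; the second case is
    contradictory.\<close>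
  show ?thesis
  proof (cases "\<exists>q. norm q \<le> \<rho> \<and> q \<noteq> 0 \<and> (\<forall>t. norm (\<Gamma> q t) \<le> \<rho>)")
    case True
    then obtain q where q: "norm q \<le> \<rho>" "q \<noteq> 0" "\<And>t. norm (\<Gamma> q t) \<le> \<rho>" by blast
    then have "range (\<lambda>t. ?P (\<Gamma> q t)) \<subseteq> ball 0 \<epsilon>" using P\<epsilon> by auto
    then show ?thesis using liftp[of q] q \<rho>V by blast
  next
    case False
    have exits: "\<exists>t. norm (\<Gamma> q t) > \<rho>" if "norm q \<le> \<rho>" "q \<noteq> 0" for q
      using False that not_le by blast
    \<comment> \<open>By periodicity the orbit is also outside the disc at some negative time, so
      going backward it meets the circle; between that moment and time 0 it stays in the
      disc.\<close>
    have backward_exit: "\<exists>\<tau>\<ge>0. norm (\<Gamma> q (- \<tau>)) = \<rho> \<and> (\<forall>s\<in>{0..\<tau>}. norm (\<Gamma> q (- s)) \<le> \<rho>)"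
      if q: "norm q \<le> \<rho>" "q \<noteq> 0" for q
    proof -
      have qV: "q \<in> V - {0}" using q \<rho>V by simp
      obtain t where t: "norm (\<Gamma> q t) > \<rho>" using exits[OF q] by blast
      obtain T where T: "T > 0" "\<And>t. \<Gamma> q (t + T) = \<Gamma> q t"
        using \<Gamma>(1)[OF qV] by (auto simp: periodic_solution_def)
      obtain s where s: "s < 0" "\<Gamma> q s = \<Gamma> q t"
        by (rule periodic_attained_earlier[of T "\<Gamma> q" 0 t]) (use T in auto)
      have "continuous_on UNIV (\<lambda>t. norm (\<Gamma> q (- t)))"
        by (intro continuous_on_norm continuous_on_compose2[OF cont\<Gamma>[OF qV]] continuous_intros) simp
      then obtain \<tau> where "\<tau> \<ge> 0" "norm (\<Gamma> q (- \<tau>)) = \<rho>" "\<And>s. s \<in> {0..\<tau>} \<Longrightarrow> norm (\<Gamma> q (- s)) \<le> \<rho>"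
        by (rule first_hit[of _ "- s" \<rho>]) (use s t q \<Gamma>(2)[OF qV] in auto)
      then show ?thesis by blast
    qed
    \<comment> \<open>Any sequence of nonzero points of the disc tending to the origin would serve;
      this one lies on the first axis.\<close>
    define q :: "nat \<Rightarrow> real^2" where "q n = (\<rho> / real (Suc n)) *\<^sub>R axis 1 1" for n
    have normq: "norm (q n) = \<rho> / real (Suc n)" for n
      using \<rho> by (simp add: q_def norm_axis_1)
    have q: "norm (q n) \<le> \<rho>" "q n \<noteq> 0" for n
    proof -
      show "norm (q n) \<le> \<rho>" unfolding normq using \<rho>(1) by (simp add: field_simps)
      have "norm (q n) \<noteq> 0" unfolding normq using \<rho>(1) by simp
      then show "q n \<noteq> 0" by auto
    qed
    have qV: "q n \<in> V - {0}" for n using q \<rho>V by simp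
    obtain \<tau> where \<tau>: "\<And>n. \<tau> n \<ge> 0" "\<And>n. norm (\<Gamma> (q n) (- \<tau> n)) = \<rho>"
      "\<And>n s. s \<in> {0..\<tau> n} \<Longrightarrow> norm (\<Gamma> (q n) (- s)) \<le> \<rho>"
      using backward_exit[OF q] by metis
    have "seq_compact (sphere 0 \<rho> :: (real^2) set)"
      by (rule compact_imp_seq_compact[OF compact_sphere])
    moreover have "\<forall>n. \<Gamma> (q n) (- \<tau> n) \<in> sphere 0 \<rho>" using \<tau>(2) by simp
    ultimately obtain p \<phi> where p: "p \<in> sphere 0 \<rho>" "strict_mono (\<phi> :: nat \<Rightarrow> nat)"
      "((\<lambda>n. \<Gamma> (q n) (- \<tau> n)) \<circ> \<phi>) \<longlonglongrightarrow> p"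
      by (rule seq_compactE)
    have p0: "norm p = \<rho>" "p \<noteq> 0" using p(1) \<rho> by auto
    then have pV: "p \<in> V - {0}" using \<rho>V by simp
    obtain t where t: "norm (\<Gamma> p t) > \<rho>" using exits[of p] p0 by auto
    obtain S where S: "S > 0" "\<And>t. \<Gamma> p (t + S) = \<Gamma> p t"
      using \<Gamma>(1)[OF pV] by (auto simp: periodic_solution_def)
    obtain T where T: "T > 0" "norm (\<Gamma> p T) > \<rho>"
      by (rule periodic_attained_later[of S "\<Gamma> p" 0 t]) (use S t in auto)
    obtain R where R: "\<And>t. norm (?P (\<Gamma> p t)) \<le> R"
      using periodic_solution_bounded[OF liftp[OF pV]] by (auto simp: bounded_iff)
    \<comment> \<open>\<open>K\<close> contains the lift of the disc and also the whole lifted orbit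
      of \<open>p\<close>, which may leave the small ball.\<close>
    define K where "K = cball (0 :: real^3) (max R \<epsilon>)"
    obtain L where L: "L-lipschitz_on K G" using lip unfolding K_def by blast
    have L0: "L \<ge> 0" by (rule lipschitz_on_nonneg[OF L])
    have PK: "?P x \<in> K" if "norm x \<le> \<rho>" for x using P\<epsilon>[OF that] by (simp add: K_def)
    \<comment> \<open>Compared with the zero solution, a backward exit before time \<open>T\<close>
      would enlarge the distance to the origin at most by the factor \<open>exp (L * T)\<close>, too
      little to reach the circle.\<close>
    have long: "\<tau> n \<ge> T" if n: "norm (?P (q n)) * exp (L * T) < \<rho>" for n
    proof (rule ccontr)
      assume "\<not> \<tau> n \<ge> T"
      have "norm (?P (\<Gamma> (q n) (- \<tau> n)) - 0) \<le> norm (?P (\<Gamma> (q n) 0) - 0) * exp (L * (0 - (- \<tau> n)))"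
      proof (rule solutions_gronwall_backward[OF L, where v = "\<lambda>_. 0"])
        show "(\<lambda>t. ?P (\<Gamma> (q n) t)) ` {- \<tau> n..0} \<subseteq> K"
          using \<tau>(3)[of "- _" n] PK by force
        show "(\<lambda>_. 0) ` {- \<tau> n..0} \<subseteq> K" using \<epsilon> by (auto simp: K_def)
      qed (use \<tau>(1) lift[OF qV] G0 in \<open>auto simp: solution_on_def\<close>)
      also have "\<dots> = norm (?P (q n)) * exp (L * \<tau> n)" using \<Gamma>(2)[OF qV] by simp
      also have "\<dots> \<le> norm (?P (q n)) * exp (L * T)"
        using \<open>\<not> \<tau> n \<ge> T\<close> L0 by (intro mult_left_mono) (auto intro: mult_left_mono)
      also have "\<dots> < \<rho>" by (rule n)
      finally show False
        using norm_xy_part_le[of "?P (\<Gamma> (q n) (- \<tau> n))"] \<tau>(2)[of n] by simp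
    qed
    \<comment> \<open>The orbit started at the exit point stays in the disc until time
      \<open>\<tau> n\<close>, hence until \<open>T\<close>, and over this time the orbit of
      \<open>p\<close> shadows it.\<close>
    have follow: "norm (\<Gamma> p T) \<le> \<rho> + norm (?P (\<Gamma> (q n) (- \<tau> n)) - ?P p) * exp (L * T)"
      if n: "\<tau> n \<ge> T" for n
    proof -
      let ?u = "\<lambda>t. ?P (\<Gamma> (q n) (t + - \<tau> n))" and ?v = "\<lambda>t. ?P (\<Gamma> p t)"
      have in\<rho>: "norm (\<Gamma> (q n) (t + - \<tau> n)) \<le> \<rho>" if "t \<in> {0..T}" for t
        using \<tau>(3)[of "\<tau> n - t" n] that n by simp
      have "norm (?u T - ?v T) \<le> norm (?u 0 - ?v 0) * exp (L * (T - 0))"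
      proof (rule solutions_gronwall[OF L])
        show "?u ` {0..T} \<subseteq> K" using PK[OF in\<rho>] by blast
        show "?v ` {0..T} \<subseteq> K" using R by (auto simp: K_def le_max_iff_disj)
      qed (use T(1) solution_shift[OF lift[OF qV], of n "- \<tau> n"] lift[OF pV] in \<open>auto simp: solution_on_def\<close>)
      moreover have "norm (\<Gamma> (q n) (T + - \<tau> n) - \<Gamma> p T) \<le> norm (?u T - ?v T)"
        using norm_xy_part_le[of "?u T - ?v T"]
        by (simp add: linear_diff[OF bounded_linear.linear[OF bounded_linear_xy_part]])
      moreover have "norm (\<Gamma> p T) \<le> norm (\<Gamma> (q n) (T + - \<tau> n)) + norm (\<Gamma> (q n) (T + - \<tau> n) - \<Gamma> p T)"
        by (metis norm_minus_commute norm_triangle_sub)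
      ultimately show ?thesis using in\<rho>[of T] T(1) \<Gamma>(2)[OF pV] by simp
    qed
    have q_lim: "q \<longlonglongrightarrow> 0"
    proof (rule tendsto_norm_zero_cancel)
      show "(\<lambda>n. norm (q n)) \<longlonglongrightarrow> 0"
        unfolding normq by (rule LIMSEQ_Suc[OF lim_const_over_n])
    qed
    have "(\<lambda>n. norm (?P (q n)) * exp (L * T)) \<longlonglongrightarrow> norm (?P 0) * exp (L * T)"
      by (intro tendsto_intros isCont_tendsto_compose[OF \<open>isCont ?P 0\<close> q_lim])
    then have "eventually (\<lambda>n. norm (?P (q n)) * exp (L * T) < \<rho>) sequentially"
      using P0 \<rho>(1) by (intro order_tendstoD(2)) auto
    then have "eventually (\<lambda>n. norm (?P (q (\<phi> n))) * exp (L * T) < \<rho>) sequentially"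
      by (rule eventually_subseq[OF p(2)])
    then have ev: "eventually (\<lambda>n. norm (\<Gamma> p T) \<le>
        \<rho> + norm (?P (\<Gamma> (q (\<phi> n)) (- \<tau> (\<phi> n))) - ?P p) * exp (L * T)) sequentially"
      by eventually_elim (intro follow long)
    have "isCont ?P p"
      using contP V pV \<open>open U\<close> by (auto simp: continuous_on_eq_continuous_at)
    then have "(\<lambda>n. ?P (\<Gamma> (q (\<phi> n)) (- \<tau> (\<phi> n)))) \<longlonglongrightarrow> ?P p"
      by (rule isCont_tendsto_compose) (use p(3) in \<open>simp add: o_def\<close>)
    then have "(\<lambda>n. \<rho> + norm (?P (\<Gamma> (q (\<phi> n)) (- \<tau> (\<phi> n))) - ?P p) * exp (L * T)) \<longlonglongrightarrow>
        \<rho> + norm (?P p - ?P p) * exp (L * T)"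
      by (intro tendsto_intros)
    \<comment> \<open>In the limit the error vanishes, so the orbit of \<open>p\<close> is in the
      disc at time \<open>T\<close>, against the choice of \<open>T\<close>.\<close>
    then have "norm (\<Gamma> p T) \<le> \<rho> + norm (?P p - ?P p) * exp (L * T)"
      by (rule tendsto_lowerbound[OF _ ev]) simp
    then show ?thesis using T(2) by simp
  qed
qed

section \<open>Lyapunov functions\<close>

text \<open>A nondecreasing function with equal values at \<open>t - T/2\<close> and
  \<open>t + T/2\<close> is constant in between.\<close>

lemma periodic_deriv_nonneg_imp_zero:
  fixes f f' :: "real \<Rightarrow> real"
  assumes T: "T > 0" "\<And>t. f (t + T) = f t"
    and f: "\<And>t. (f has_real_derivative f' t) (at t)" "\<And>t. f' t \<ge> 0"
  shows "f' t = 0"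
proof (rule DERIV_local_const[OF f(1)])
  have mono: "f a \<le> f b" if "a \<le> b" for a b
    using DERIV_nonneg_imp_nondecreasing[OF that] f by blast
  have per: "f (t + T/2) = f (t - T/2)" using T(2)[of "t - T/2"] by (simp add: add.commute)
  show "\<forall>y. \<bar>t - y\<bar> < T/2 \<longrightarrow> f t = f y"
  proof (intro allI impI)
    fix y assume "\<bar>t - y\<bar> < T/2"
    then have "t - T/2 \<le> y" "y \<le> t + T/2" by linarith+
    then have "f (t - T/2) \<le> f y" "f y \<le> f (t + T/2)" by (intro mono; simp)+
    moreover have "f (t - T/2) \<le> f t" "f t \<le> f (t + T/2)" using T by (auto intro!: mono)
    ultimately show "f t = f y" using per by linarith
  qed
qed (use T in simp)

text \<open>The smallness conditions of the estimates below are collected in an open set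
  \<open>W\<close>; this extracts one \<open>\<epsilon>\<close> for all of them.\<close>

lemma open_contains_box3:
  fixes W :: "(real \<times> real \<times> real) set"
  assumes "open W" "(0, 0, 0) \<in> W"
  shows "\<exists>\<epsilon>>0. \<forall>x v y. \<bar>x\<bar> < \<epsilon> \<longrightarrow> \<bar>v\<bar> < \<epsilon> \<longrightarrow> \<bar>y\<bar> < \<epsilon> \<longrightarrow> (x, v, y) \<in> W"
proof -
  obtain e where e: "e > 0" "ball (0, 0, 0) e \<subseteq> W"
    using assms by (meson open_contains_ball)
  have "(x, v, y) \<in> W" if "\<bar>x\<bar> < e/3" "\<bar>v\<bar> < e/3" "\<bar>y\<bar> < e/3" for x v y
  proof -
    have "norm (x, v, y) \<le> norm x + (norm v + norm y)"
      using norm_Pair_le[of x "(v, y)"] norm_Pair_le[of v y] by linarith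
    then have "norm (x, v, y) < e" using that by simp
    then show ?thesis using e(2) by (auto simp: dist_norm subset_iff norm_minus_commute)
  qed
  then show ?thesis using e(1) by (intro exI[of _ "e/3"]) auto
qed

text \<open>This absorbs mixed products with small coefficients into positive definite
  squares.\<close>

lemma abs_mult_le_half_squares:
  fixes e a b :: real
  assumes "\<bar>e\<bar> \<le> \<delta>"
  shows "\<bar>e * (a * b)\<bar> \<le> \<delta> * (a\<^sup>2 + b\<^sup>2) / 2"
proof -
  have "2 * (\<bar>a\<bar> * \<bar>b\<bar>) \<le> \<bar>a\<bar>\<^sup>2 + \<bar>b\<bar>\<^sup>2" using sum_squares_bound[of "\<bar>a\<bar>" "\<bar>b\<bar>"] by simp
  then have "\<bar>a * b\<bar> \<le> (a\<^sup>2 + b\<^sup>2) / 2" by (simp add: abs_mult)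
  then have "\<bar>e\<bar> * \<bar>a * b\<bar> \<le> \<delta> * ((a\<^sup>2 + b\<^sup>2) / 2)"
    using assms by (intro mult_mono) auto
  then show ?thesis by (simp add: abs_mult)
qed

text \<open>
  The dynamo system at a nilpotent point after rescaling.  The factor \<open>l\<close>, which may be negative,
  stands for a change of the time unit that is not carried out.
\<close>

definition solves_normal_form ::
    "real \<Rightarrow> real \<Rightarrow> real \<Rightarrow> (real \<Rightarrow> real) \<Rightarrow> (real \<Rightarrow> real) \<Rightarrow> (real \<Rightarrow> real) \<Rightarrow> bool" where
  "solves_normal_form l k \<sigma> x v y \<longleftrightarrow>
     (\<forall>t. (x has_real_derivative l * (v t + x t * y t)) (at t) \<and>
          (v has_real_derivative l * (x t * y t)) (at t) \<and>
          (y has_real_derivative - (l * k) * (y t + \<sigma> * (x t)\<^sup>2)) (at t))"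

text \<open>\<open>N\<close> is the derivative of \<open>L\<close> along the flow in rescaled time.
  It is fixed before \<open>l\<close>, so one \<open>\<epsilon>\<close> serves every
  \<open>l\<close> of either sign.\<close>

definition locally_strict_lyapunov :: "real \<Rightarrow> real \<Rightarrow> (real \<Rightarrow> real \<Rightarrow> real \<Rightarrow> real) \<Rightarrow> bool" where
  "locally_strict_lyapunov k \<sigma> L \<longleftrightarrow>
     (\<exists>N \<epsilon>. \<epsilon> > 0 \<and>
        (\<forall>l x v y t. solves_normal_form l k \<sigma> x v y \<longrightarrow>
           ((\<lambda>t. L (x t) (v t) (y t)) has_real_derivative l * N (x t) (v t) (y t)) (at t)) \<and>
        (\<forall>x v y. \<bar>x\<bar> < \<epsilon> \<longrightarrow> \<bar>v\<bar> < \<epsilon> \<longrightarrow> \<bar>y\<bar> < \<epsilon> \<longrightarrow>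
           N x v y \<ge> 0 \<and> (N x v y = 0 \<longrightarrow> x = 0 \<and> v = 0 \<and> y = 0)))"

lemma lyapunov_no_small_periodic:
  assumes "locally_strict_lyapunov k \<sigma> L"
  shows "\<exists>\<epsilon>>0. \<forall>l x v y T. l \<noteq> 0 \<longrightarrow> T > 0 \<longrightarrow> solves_normal_form l k \<sigma> x v y \<longrightarrow>
    (\<forall>t. x (t + T) = x t \<and> v (t + T) = v t \<and> y (t + T) = y t) \<longrightarrow>
    (\<forall>t. \<bar>x t\<bar> < \<epsilon> \<and> \<bar>v t\<bar> < \<epsilon> \<and> \<bar>y t\<bar> < \<epsilon>) \<longrightarrow> (\<forall>t. x t = 0 \<and> v t = 0 \<and> y t = 0)"
proof -
  obtain N \<epsilon> where \<epsilon>: "\<epsilon> > 0"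
    and der: "\<And>l x v y t. solves_normal_form l k \<sigma> x v y \<Longrightarrow>
           ((\<lambda>t. L (x t) (v t) (y t)) has_real_derivative l * N (x t) (v t) (y t)) (at t)"
    and N: "\<And>x v y. \<bar>x\<bar> < \<epsilon> \<Longrightarrow> \<bar>v\<bar> < \<epsilon> \<Longrightarrow> \<bar>y\<bar> < \<epsilon> \<Longrightarrow>
           N x v y \<ge> 0 \<and> (N x v y = 0 \<longrightarrow> x = 0 \<and> v = 0 \<and> y = 0)"
    using assms unfolding locally_strict_lyapunov_def by blast
  show ?thesis
  proof (intro exI[of _ \<epsilon>] conjI \<epsilon> allI impI)
    fix l x v y T t
    assume l: "l \<noteq> 0" and T: "T > 0" and sol: "solves_normal_form l k \<sigma> x v y"
      and per: "\<forall>t. x (t + T) = x t \<and> v (t + T) = v t \<and> y (t + T) = y t"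
      and small: "\<forall>t. \<bar>x t\<bar> < \<epsilon> \<and> \<bar>v t\<bar> < \<epsilon> \<and> \<bar>y t\<bar> < \<epsilon>"
    \<comment> \<open>Division by \<open>l\<close> makes the function nondecreasing along the small
      solution whatever the sign of \<open>l\<close>.\<close>
    have "((\<lambda>t. L (x t) (v t) (y t) / l) has_real_derivative N (x t) (v t) (y t)) (at t)" for t
      using DERIV_cdivide[OF der[OF sol], of l] l by simp
    then have "N (x t) (v t) (y t) = 0"
      by (rule periodic_deriv_nonneg_imp_zero[OF T, rotated]) (use per small N in auto)
    then show "x t = 0" "v t = 0" "y t = 0" using N[of "x t" "v t" "y t"] small by auto
  qed
qed

text \<open>Near y = x^2 the system is to leading order the saddle x' = v, v' = x^3, up to the
  factor \<open>l\<close>. There x v has derivative v^2 + x^4, and the second summand adds 2 (y -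
  x^2)^2 to control the deviation from the surface.\<close>

lemma lyapunov_negative_sign:
  assumes k: "k \<noteq> 0"
  shows "locally_strict_lyapunov k (- 1) (\<lambda>x v y. x * v - (y - x\<^sup>2)\<^sup>2 / k)"
proof -
  \<comment> \<open>With \<open>j\<close> for the reciprocal of \<open>k\<close> the derivative
    formulas are polynomial identities modulo \<open>k * j = 1\<close>.\<close>
  define j where "j = 1 / k"
  have j: "k * j = 1" using k by (simp add: j_def)
  define N :: "real \<Rightarrow> real \<Rightarrow> real \<Rightarrow> real" where
    "N x v y = (v + x * y) * v + x * (x * y) - 2 * j * (y - x\<^sup>2) * (- k * (y - x\<^sup>2) - 2 * x * (v + x * y))" for x v y
  define W :: "(real \<times> real \<times> real) set" where
    "W = {(x, v, y). \<bar>x + 4 * j * x\<bar> < 1/4 \<and> \<bar>x\<bar> < 1/4 \<and> \<bar>4 * j * y\<bar> < 1/4}"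
  have "open W" unfolding W_def case_prod_unfold
    by (intro open_Collect_conj open_Collect_less continuous_intros)
  then obtain \<epsilon> where \<epsilon>: "\<epsilon> > 0"
    "\<And>x v y. \<bar>x\<bar> < \<epsilon> \<Longrightarrow> \<bar>v\<bar> < \<epsilon> \<Longrightarrow> \<bar>y\<bar> < \<epsilon> \<Longrightarrow> (x, v, y) \<in> W"
    using open_contains_box3[of W] by (auto simp: W_def)
  have N: "N x v y \<ge> 0 \<and> (N x v y = 0 \<longrightarrow> x = 0 \<and> v = 0 \<and> y = 0)" if "(x, v, y) \<in> W" for x v y
  proof -
    define R where "R = y - x\<^sup>2"
    have "N x v y = v\<^sup>2 + (x\<^sup>2)\<^sup>2 + x\<^sup>2 * R + 2 * R\<^sup>2
        + (x + 4 * j * x) * (v * R) + x * (x\<^sup>2 * v) + 4 * j * y * (x\<^sup>2 * R)"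
      unfolding N_def R_def using j by algebra
    moreover have e: "\<bar>x + 4 * j * x\<bar> \<le> 1/4" "\<bar>x\<bar> \<le> 1/4" "\<bar>4 * j * y\<bar> \<le> 1/4"
      using that by (simp_all add: W_def)
    have "\<bar>(x + 4 * j * x) * (v * R)\<bar> \<le> 1/4 * (v\<^sup>2 + R\<^sup>2) / 2"
      "\<bar>x * (x\<^sup>2 * v)\<bar> \<le> 1/4 * ((x\<^sup>2)\<^sup>2 + v\<^sup>2) / 2"
      "\<bar>4 * j * y * (x\<^sup>2 * R)\<bar> \<le> 1/4 * ((x\<^sup>2)\<^sup>2 + R\<^sup>2) / 2"
      by (rule abs_mult_le_half_squares e)+
    \<comment> \<open>This product has no small coefficient; the coefficients 1 of x^4 and 2 of R^2
      leave room for it.\<close>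
    moreover have "\<bar>1 * (x\<^sup>2 * R)\<bar> \<le> 1 * ((x\<^sup>2)\<^sup>2 + R\<^sup>2) / 2"
      by (rule abs_mult_le_half_squares) simp
    ultimately have "8 * N x v y \<ge> v\<^sup>2 + x ^ 4 + R\<^sup>2 + 5 * v\<^sup>2 + x ^ 4 + 9 * R\<^sup>2"
      unfolding abs_le_iff by (simp add: algebra_simps)
    moreover have nn: "0 \<le> v\<^sup>2" "0 \<le> x ^ 4" "0 \<le> R\<^sup>2" by auto
    ultimately have le: "8 * N x v y \<ge> v\<^sup>2 + x ^ 4 + R\<^sup>2" by linarith
    show ?thesis
    proof (intro conjI impI)
      show "N x v y \<ge> 0" using le nn by linarith
      assume "N x v y = 0"
      then have "v\<^sup>2 = 0" "x ^ 4 = 0" "R\<^sup>2 = 0" using le nn by linarith+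
      then show "x = 0" "v = 0" "y = 0" by (auto simp: R_def)
    qed
  qed
  have "((\<lambda>t. x t * v t - (y t - (x t)\<^sup>2)\<^sup>2 / k) has_real_derivative l * N (x t) (v t) (y t)) (at t)"
    if sol: "solves_normal_form l k (- 1) x v y" for l x v y t
  proof -
    have d: "(x has_real_derivative l * (v t + x t * y t)) (at t)"
      "(v has_real_derivative l * (x t * y t)) (at t)"
      "(y has_real_derivative - (l * k) * (y t - (x t)\<^sup>2)) (at t)"
      using sol by (auto simp: solves_normal_form_def)
    have "((\<lambda>t. x t * v t - (y t - (x t)\<^sup>2)\<^sup>2 * j) has_real_derivative l * N (x t) (v t) (y t)) (at t)"
      by (rule derivative_eq_intros d refl)+ (simp add: N_def; algebra)
    then show ?thesis by (simp add: j_def)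
  qed
  then show ?thesis
    unfolding locally_strict_lyapunov_def
    by (intro exI[of _ N] exI[of _ \<epsilon>]) (use N \<epsilon> in blast)
qed


text \<open>
  Near the origin \<open>y = - x\<^sup>2 + (2 / k) x v + S\<close> with \<open>S\<close> of higher order.  Give \<open>x\<close>, \<open>v\<close>, \<open>S\<close>
  the weights 1, 2, 4.  In weight 6 the derivative of \<open>v\<^sup>2 / 2 + x\<^sup>4 / 4\<close> is congruent, modulo
  derivatives, to \<open>(2 / k - 3) x\<^sup>2 v\<^sup>2\<close>, and the term \<open>x\<^sup>3 v\<close> distributes this over
  \<open>x\<^sup>2 v\<^sup>2\<close> and \<open>x\<^sup>6\<close>.  These two vanish for \<open>x = 0\<close>; the terms \<open>x v\<^sup>3\<close> and \<open>S\<^sup>2\<close> with large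
  coefficients contribute \<open>v\<^sup>4\<close> and \<open>S\<^sup>2\<close> and absorb the mixed products.
\<close>

lemma lyapunov_positive_sign_nonresonant:
  assumes k: "k \<noteq> 0" "k \<noteq> 2/3"
  shows "\<exists>L. locally_strict_lyapunov k 1 L"
proof -
  define j where "j = 1 / k"
  have j: "k * j = 1" using k by (simp add: j_def)
  \<comment> \<open>In \<open>N\<close> the coefficient of x^6 is 1 and that of (x v)^2 is
    \<open>P * (3 - 2 * j) - 3\<close>; this choice makes the latter 3.\<close>
  define P where "P = 6 / (3 - 2 * j)"
  have "3 - 2 * j \<noteq> 0" using k by (simp add: j_def field_simps)
  then have P: "P * (3 - 2 * j) = 6" by (metis P_def nonzero_divide_eq_eq)
  then have "P \<noteq> 0" by auto
  \<comment> \<open>\<open>B\<close> and \<open>A\<close> let squares be completed: P b d is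
    absorbed by b^2 and B d^2 / 4, and 2 B j^2 c d by (A - 1) c^2 and B d^2 / 4, with
    \<open>b\<close>, \<open>c\<close>, \<open>d\<close> as below.\<close>
  define B where "B = P\<^sup>2"
  have "B > 0" using \<open>P \<noteq> 0\<close> by (simp add: B_def)
  define A where "A = 4 * B * j ^ 4 + 1"
  define L :: "real \<Rightarrow> real \<Rightarrow> real \<Rightarrow> real" where
    "L x v y = A * x * v ^ 3 - P * (v\<^sup>2 / 2 + x ^ 4 / 4) - (1 - P) * x ^ 3 * v
      - B * j / 2 * (y + x\<^sup>2 - 2 * j * x * v)\<^sup>2" for x v y
  define N :: "real \<Rightarrow> real \<Rightarrow> real \<Rightarrow> real" where
    "N x v y = A * ((v + x * y) * v ^ 3 + 3 * x * v\<^sup>2 * (x * y))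
      - P * (v * (x * y) + x ^ 3 * (v + x * y))
      - (1 - P) * (3 * x\<^sup>2 * (v + x * y) * v + x ^ 3 * (x * y))
      - B * j * (y + x\<^sup>2 - 2 * j * x * v) *
          (- k * (y + x\<^sup>2) + 2 * x * (v + x * y) - 2 * j * ((v + x * y) * v + x * (x * y)))" for x v y
  define \<delta> where "\<delta> = min (1/4) (B/8)"
  have \<delta>: "\<delta> > 0" "\<delta> \<le> 1/4" "\<delta> \<le> B/8" using \<open>B > 0\<close> by (auto simp: \<delta>_def)
  define W :: "(real \<times> real \<times> real) set" where
    "W = {(x, v, y). \<bar>(3 - 3 * P - 2 * j) * x\<bar> < \<delta> \<and> \<bar>(2 * B * j * (1 - j) - 1) * x\<bar> < \<delta>
      \<and> \<bar>(3 * P - 3) * (2 * j) * x\<^sup>2 + 3 * A * y\<bar> < \<delta> \<and> \<bar>A * y\<bar> < \<delta> \<and> \<bar>2 * B * j * (1 - j) * x\<^sup>2\<bar> < \<delta>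
      \<and> \<bar>(3 * P - 3) * x\<^sup>2 - 4 * B * j\<^sup>2 * (1 - j) * x\<^sup>2 + 2 * B * j\<^sup>2 * y\<bar> < \<delta>}"
  have "open W" unfolding W_def case_prod_unfold
    by (intro open_Collect_conj open_Collect_less continuous_intros)
  then obtain \<epsilon> where \<epsilon>: "\<epsilon> > 0"
    "\<And>x v y. \<bar>x\<bar> < \<epsilon> \<Longrightarrow> \<bar>v\<bar> < \<epsilon> \<Longrightarrow> \<bar>y\<bar> < \<epsilon> \<Longrightarrow> (x, v, y) \<in> W"
    using open_contains_box3[of W] \<delta> by (auto simp: W_def)
  have N: "N x v y \<ge> 0 \<and> (N x v y = 0 \<longrightarrow> x = 0 \<and> v = 0 \<and> y = 0)" if "(x, v, y) \<in> W" for x v y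
  proof -
    define a where "a = x ^ 3"
    define b where "b = x * v"
    define c where "c = v\<^sup>2"
    define d where "d = y + x\<^sup>2 - 2 * j * x * v"
    have e: "\<bar>(3 - 3 * P - 2 * j) * x\<bar> \<le> \<delta>" "\<bar>(2 * B * j * (1 - j) - 1) * x\<bar> \<le> \<delta>"
      "\<bar>(3 * P - 3) * (2 * j) * x\<^sup>2 + 3 * A * y\<bar> \<le> \<delta>" "\<bar>A * y\<bar> \<le> \<delta>" "\<bar>2 * B * j * (1 - j) * x\<^sup>2\<bar> \<le> \<delta>"
      "\<bar>(3 * P - 3) * x\<^sup>2 - 4 * B * j\<^sup>2 * (1 - j) * x\<^sup>2 + 2 * B * j\<^sup>2 * y\<bar> \<le> \<delta>"
      using that by (simp_all add: W_def)
    have y: "y = d - x\<^sup>2 + 2 * j * x * v" by (simp add: d_def)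
    \<comment> \<open>\<open>N\<close> is written as a quadratic form in \<open>a\<close>,
      \<open>b\<close>, \<open>c\<close>, \<open>d\<close>. The first line has constant
      coefficients; the others vanish at the origin and are below \<open>\<delta>\<close> on
      \<open>W\<close>.\<close>
    have "N x v y = a\<^sup>2 + 3 * b\<^sup>2 + A * c\<^sup>2 + B * d\<^sup>2 - P * (b * d) + 2 * B * j\<^sup>2 * (c * d)
        + (3 - 3 * P - 2 * j) * x * (a * b) + (2 * B * j * (1 - j) - 1) * x * (a * d)
        + ((3 * P - 3) * (2 * j) * x\<^sup>2 + 3 * A * y) * (b * b) + A * y * (b * c)
        - 2 * B * j * (1 - j) * x\<^sup>2 * (d * d)
        + ((3 * P - 3) * x\<^sup>2 - 4 * B * j\<^sup>2 * (1 - j) * x\<^sup>2 + 2 * B * j\<^sup>2 * y) * (b * d)"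
      unfolding N_def a_def b_def c_def d_def using j P by algebra
    moreover have
      "\<bar>(3 - 3 * P - 2 * j) * x * (a * b)\<bar> \<le> \<delta> * (a\<^sup>2 + b\<^sup>2) / 2"
      "\<bar>(2 * B * j * (1 - j) - 1) * x * (a * d)\<bar> \<le> \<delta> * (a\<^sup>2 + d\<^sup>2) / 2"
      "\<bar>((3 * P - 3) * (2 * j) * x\<^sup>2 + 3 * A * y) * (b * b)\<bar> \<le> \<delta> * (b\<^sup>2 + b\<^sup>2) / 2"
      "\<bar>A * y * (b * c)\<bar> \<le> \<delta> * (b\<^sup>2 + c\<^sup>2) / 2"
      "\<bar>2 * B * j * (1 - j) * x\<^sup>2 * (d * d)\<bar> \<le> \<delta> * (d\<^sup>2 + d\<^sup>2) / 2"
      "\<bar>((3 * P - 3) * x\<^sup>2 - 4 * B * j\<^sup>2 * (1 - j) * x\<^sup>2 + 2 * B * j\<^sup>2 * y) * (b * d)\<bar> \<le> \<delta> * (b\<^sup>2 + d\<^sup>2) / 2"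
      by (rule abs_mult_le_half_squares e)+
    moreover have "P * (b * d) \<le> b\<^sup>2 + B / 4 * d\<^sup>2"
      using zero_le_power2[of "b - P / 2 * d"]
      by (simp add: B_def power2_eq_square algebra_simps)
    moreover have "- (2 * B * j\<^sup>2 * (c * d)) \<le> (A - 1) * c\<^sup>2 + B / 4 * d\<^sup>2"
    proof -
      have "0 \<le> B * (2 * j\<^sup>2 * c + d / 2)\<^sup>2" using \<open>B > 0\<close> by simp
      also have "\<dots> = (A - 1) * c\<^sup>2 + B / 4 * d\<^sup>2 + 2 * B * j\<^sup>2 * (c * d)"
        by (simp add: A_def power2_eq_square power4_eq_xxxx field_simps)
      finally show ?thesis by simp
    qed
    moreover have "\<delta> * a\<^sup>2 \<le> 1/4 * a\<^sup>2" "\<delta> * b\<^sup>2 \<le> 1/4 * b\<^sup>2" "\<delta> * c\<^sup>2 \<le> 1/4 * c\<^sup>2" "\<delta> * d\<^sup>2 \<le> B/8 * d\<^sup>2"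
      using \<delta> by (intro mult_right_mono; simp)+
    ultimately have le: "N x v y \<ge> a\<^sup>2 / 4 + b\<^sup>2 / 4 + c\<^sup>2 / 4 + B / 8 * d\<^sup>2"
      using zero_le_power2[of a] zero_le_power2[of b] zero_le_power2[of c]
        mult_nonneg_nonneg[OF less_imp_le[OF \<open>B > 0\<close>] zero_le_power2[of d]]
      unfolding abs_le_iff by (simp add: algebra_simps)
    have nn: "0 \<le> a\<^sup>2" "0 \<le> b\<^sup>2" "0 \<le> c\<^sup>2" "0 \<le> B / 8 * d\<^sup>2" using \<open>B > 0\<close> by auto
    show ?thesis
    proof (intro conjI impI)
      show "N x v y \<ge> 0" using le nn by linarith
      assume "N x v y = 0"
      then have "a\<^sup>2 = 0" "c\<^sup>2 = 0" "B / 8 * d\<^sup>2 = 0" using le nn by linarith+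
      then show "x = 0" "v = 0" "y = 0" using \<open>B > 0\<close> by (auto simp: a_def c_def d_def)
    qed
  qed
  have "((\<lambda>t. L (x t) (v t) (y t)) has_real_derivative l * N (x t) (v t) (y t)) (at t)"
    if sol: "solves_normal_form l k 1 x v y" for l x v y t
  proof -
    have d: "(x has_real_derivative l * (v t + x t * y t)) (at t)"
      "(v has_real_derivative l * (x t * y t)) (at t)"
      "(y has_real_derivative - (l * k) * (y t + (x t)\<^sup>2)) (at t)"
      using sol by (auto simp: solves_normal_form_def)
    have nz: "(2::real) \<noteq> 0" "(4::real) \<noteq> 0" by simp_all
    show ?thesis unfolding L_def
      by (rule derivative_eq_intros d refl nz)+ (simp add: N_def; algebra)
  qed
  then show ?thesis
    unfolding locally_strict_lyapunov_def
    by (intro exI[of _ L] exI[of _ N] exI[of _ \<epsilon>]) (use N \<epsilon> in blast)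
qed

text \<open>
  For \<open>k = 2/3\<close> the obstruction in weight 6 vanishes.  The coefficients of \<open>Q\<close> solve the linear
  system saying that its derivative has no terms of weight below 8 and that the part of weight 8
  is \<open>180 x\<^sup>8 + 180 v\<^sup>4 + 20 S\<^sup>2\<close>.
\<close>

lemma lyapunov_positive_sign_resonant: "\<exists>L. locally_strict_lyapunov (2/3) 1 L"
proof -
  define Q :: "real \<Rightarrow> real \<Rightarrow> real \<Rightarrow> real" where
    "Q x v S = - 29 * x ^ 4 - 58 * v\<^sup>2 + 116 * x ^ 3 * v - 261 * x\<^sup>2 * v\<^sup>2 + 36 * x ^ 5 * v - 198 * x * v ^ 3
      - 174 * x * v * S + 216 * x ^ 4 * S - 126 * v\<^sup>2 * S - 15 * S\<^sup>2" for x v S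
  \<comment> \<open>The first three terms have weight 8; all others have weight at least 9.\<close>
  define N :: "real \<Rightarrow> real \<Rightarrow> real \<Rightarrow> real" where
    "N x v S = 180 * (x ^ 4)\<^sup>2 + 180 * (v\<^sup>2)\<^sup>2 + 20 * S\<^sup>2
      - 1584 * x * (x\<^sup>2 * v * v\<^sup>2) - 72 * x * (x ^ 4 * (x\<^sup>2 * v)) + 768 * x * (x\<^sup>2 * v * S)
      + (180 * x * v - 1476 * x\<^sup>2) * (v\<^sup>2 * S) - 1404 * x\<^sup>2 * (x\<^sup>2 * v * (x\<^sup>2 * v))
      + (2124 * x * v - 1044 * x\<^sup>2) * (x ^ 4 * S) + 540 * x\<^sup>2 * (v\<^sup>2 * v\<^sup>2)
      + (864 * x ^ 4 - 144 * x\<^sup>2 - 336 * x * v) * (S * S)" for x v S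
  \<comment> \<open>The bounds on the remaining coefficients, those with 72, 768 and 540, follow
    from the ones with 1584 and 1404.\<close>
  define W :: "(real \<times> real \<times> real) set" where
    "W = {(x, v, y). \<bar>- 1584 * x\<bar> < 1 \<and> \<bar>180 * x * v - 1476 * x\<^sup>2\<bar> < 1 \<and> \<bar>- 1404 * x\<^sup>2\<bar> < 1
      \<and> \<bar>2124 * x * v - 1044 * x\<^sup>2\<bar> < 1 \<and> \<bar>864 * x ^ 4 - 144 * x\<^sup>2 - 336 * x * v\<bar> < 1}"
  have "open W" unfolding W_def case_prod_unfold
    by (intro open_Collect_conj open_Collect_less continuous_intros)
  then obtain \<epsilon> where \<epsilon>: "\<epsilon> > 0"
    "\<And>x v y. \<bar>x\<bar> < \<epsilon> \<Longrightarrow> \<bar>v\<bar> < \<epsilon> \<Longrightarrow> \<bar>y\<bar> < \<epsilon> \<Longrightarrow> (x, v, y) \<in> W"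
    using open_contains_box3[of W] by (auto simp: W_def)
  have N: "N x v (y + x\<^sup>2 - 3 * x * v) \<ge> 0 \<and>
      (N x v (y + x\<^sup>2 - 3 * x * v) = 0 \<longrightarrow> x = 0 \<and> v = 0 \<and> y = 0)" if "(x, v, y) \<in> W" for x v y
  proof -
    define S where "S = y + x\<^sup>2 - 3 * x * v"
    define a where "a = x ^ 4"
    define b where "b = x\<^sup>2 * v"
    define c where "c = v\<^sup>2"
    have e: "\<bar>- 1584 * x\<bar> \<le> 1" "\<bar>- 72 * x\<bar> \<le> 1" "\<bar>768 * x\<bar> \<le> 1"
      "\<bar>180 * x * v - 1476 * x\<^sup>2\<bar> \<le> 1" "\<bar>- 1404 * x\<^sup>2\<bar> \<le> 1" "\<bar>540 * x\<^sup>2\<bar> \<le> 1"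
      "\<bar>2124 * x * v - 1044 * x\<^sup>2\<bar> \<le> 1" "\<bar>864 * x ^ 4 - 144 * x\<^sup>2 - 336 * x * v\<bar> \<le> 1"
      using that by (simp_all add: W_def abs_mult)
    have "N x v S = 180 * a\<^sup>2 + 180 * c\<^sup>2 + 20 * S\<^sup>2
      + - 1584 * x * (b * c) + - 72 * x * (a * b) + 768 * x * (b * S)
      + (180 * x * v - 1476 * x\<^sup>2) * (c * S) + - 1404 * x\<^sup>2 * (b * b)
      + (2124 * x * v - 1044 * x\<^sup>2) * (a * S) + 540 * x\<^sup>2 * (c * c)
      + (864 * x ^ 4 - 144 * x\<^sup>2 - 336 * x * v) * (S * S)"
      by (simp add: N_def a_def b_def c_def)
    moreover have
      "\<bar>- 1584 * x * (b * c)\<bar> \<le> 1 * (b\<^sup>2 + c\<^sup>2) / 2" "\<bar>- 72 * x * (a * b)\<bar> \<le> 1 * (a\<^sup>2 + b\<^sup>2) / 2"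
      "\<bar>768 * x * (b * S)\<bar> \<le> 1 * (b\<^sup>2 + S\<^sup>2) / 2"
      "\<bar>(180 * x * v - 1476 * x\<^sup>2) * (c * S)\<bar> \<le> 1 * (c\<^sup>2 + S\<^sup>2) / 2"
      "\<bar>- 1404 * x\<^sup>2 * (b * b)\<bar> \<le> 1 * (b\<^sup>2 + b\<^sup>2) / 2"
      "\<bar>(2124 * x * v - 1044 * x\<^sup>2) * (a * S)\<bar> \<le> 1 * (a\<^sup>2 + S\<^sup>2) / 2"
      "\<bar>540 * x\<^sup>2 * (c * c)\<bar> \<le> 1 * (c\<^sup>2 + c\<^sup>2) / 2"
      "\<bar>(864 * x ^ 4 - 144 * x\<^sup>2 - 336 * x * v) * (S * S)\<bar> \<le> 1 * (S\<^sup>2 + S\<^sup>2) / 2"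
      by (rule abs_mult_le_half_squares e)+
    \<comment> \<open>The square of \<open>b\<close> is absent from the leading part, but it equals
      the product of \<open>a\<close> and \<open>c\<close>.\<close>
    moreover have "b\<^sup>2 \<le> (a\<^sup>2 + c\<^sup>2) / 2"
      using sum_squares_bound[of a c] by (simp add: a_def b_def c_def power_mult_distrib)
    moreover have nn: "0 \<le> a\<^sup>2" "0 \<le> c\<^sup>2" "0 \<le> S\<^sup>2" by auto
    ultimately have le: "N x v S \<ge> a\<^sup>2 + c\<^sup>2 + S\<^sup>2"
      unfolding abs_le_iff by (simp add: algebra_simps)
    show ?thesis unfolding S_def[symmetric]
    proof (intro conjI impI)
      show "N x v S \<ge> 0" using le nn by linarith
      assume "N x v S = 0"
      then have "a\<^sup>2 = 0" "c\<^sup>2 = 0" "S\<^sup>2 = 0" using le nn by linarith+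
      then show "x = 0" "v = 0" "y = 0" by (auto simp: a_def c_def S_def)
    qed
  qed
  have "((\<lambda>t. Q (x t) (v t) (y t + (x t)\<^sup>2 - 3 * x t * v t)) has_real_derivative
      l * N (x t) (v t) (y t + (x t)\<^sup>2 - 3 * x t * v t)) (at t)"
    if sol: "solves_normal_form l (2/3) 1 x v y" for l x v y t
  proof -
    \<comment> \<open>This is the deviation from the approximate surface y = - x^2 + (2 / k) x v,
      where 2 / k = 3.\<close>
    define S where "S t = y t + (x t)\<^sup>2 - 3 * x t * v t" for t
    have y: "y t = S t - (x t)\<^sup>2 + 3 * x t * v t" for t by (simp add: S_def)
    have d0: "(x has_real_derivative l * (v t + x t * y t)) (at t)"
      "(v has_real_derivative l * (x t * y t)) (at t)"
      "(y has_real_derivative - (l * (2/3)) * (y t + (x t)\<^sup>2)) (at t)"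
      using sol by (auto simp: solves_normal_form_def)
    have "(S has_real_derivative
        - (l * (2/3)) * (y t + (x t)\<^sup>2) + 2 * x t * (l * (v t + x t * y t))
        - (3 * (l * (v t + x t * y t)) * v t + 3 * x t * (l * (x t * y t)))) (at t)"
      unfolding S_def[abs_def] by (rule derivative_eq_intros d0 refl)+ (simp add: algebra_simps)
    note d = d0(1,2)[unfolded y] this[unfolded y]
    have "((\<lambda>t. Q (x t) (v t) (S t)) has_real_derivative l * N (x t) (v t) (S t)) (at t)"
      unfolding Q_def
      by (rule derivative_eq_intros d refl)+ (simp add: N_def field_simps; algebra)
    then show ?thesis by (simp add: S_def)
  qed
  then show ?thesis
    unfolding locally_strict_lyapunov_def
    by (intro exI[of _ "\<lambda>x v y. Q x v (y + x\<^sup>2 - 3 * x * v)"]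
        exI[of _ "\<lambda>x v y. N x v (y + x\<^sup>2 - 3 * x * v)"] exI[of _ \<epsilon>]) (use N \<epsilon> in blast)
qed

lemma normal_form_no_small_periodic:
  assumes k: "k \<noteq> 0" and \<sigma>: "\<sigma> = 1 \<or> \<sigma> = - 1"
  shows "\<exists>\<epsilon>>0. \<forall>l x v y T. l \<noteq> 0 \<longrightarrow> T > 0 \<longrightarrow> solves_normal_form l k \<sigma> x v y \<longrightarrow>
    (\<forall>t. x (t + T) = x t \<and> v (t + T) = v t \<and> y (t + T) = y t) \<longrightarrow>
    (\<forall>t. \<bar>x t\<bar> < \<epsilon> \<and> \<bar>v t\<bar> < \<epsilon> \<and> \<bar>y t\<bar> < \<epsilon>) \<longrightarrow> (\<forall>t. x t = 0 \<and> v t = 0 \<and> y t = 0)"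
proof -
  have "\<exists>L. locally_strict_lyapunov k \<sigma> L"
    using lyapunov_negative_sign[OF k] lyapunov_positive_sign_nonresonant[OF k]
      lyapunov_positive_sign_resonant \<sigma> by blast
  then show ?thesis using lyapunov_no_small_periodic by blast
qed

text \<open>The square of \<open>y\<close> is monotone for either sign of \<open>\<kappa>\<close>,
  and periodicity makes its derivative vanish.\<close>

lemma periodic_exponential_zero:
  fixes y :: "real \<Rightarrow> real"
  assumes "\<kappa> \<noteq> 0" "T > 0" "\<And>t. y (t + T) = y t" "\<And>t. (y has_real_derivative - \<kappa> * y t) (at t)"
  shows "y t = 0"
proof -
  have "((\<lambda>t. - (1 / \<kappa>) * (y t)\<^sup>2) has_real_derivative 2 * (y t)\<^sup>2) (at t)" for t
    using assms(1) by (auto intro!: derivative_eq_intros assms(4) simp: power2_eq_square)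
  then have "2 * (y t)\<^sup>2 = 0"
    by (rule periodic_deriv_nonneg_imp_zero[OF assms(2), rotated]) (use assms(3) in auto)
  then show ?thesis by simp
qed

section \<open>The dynamo system\<close>

text \<open>Here \<open>y\<close> is measured from the singular point, and \<open>\<beta> = l\<^sup>2\<close>, \<open>\<alpha> = \<kappa> (l + 1)\<close>.\<close>

definition solves_nilpotent_dynamo ::
    "real \<Rightarrow> real \<Rightarrow> (real \<Rightarrow> real) \<Rightarrow> (real \<Rightarrow> real) \<Rightarrow> (real \<Rightarrow> real) \<Rightarrow> bool" where
  "solves_nilpotent_dynamo l \<kappa> x y z \<longleftrightarrow>
     (\<forall>t. (x has_real_derivative l * (x t - l * z t) + x t * y t) (at t) \<and>
          (y has_real_derivative - \<kappa> * (y t + (l + 1) * (x t)\<^sup>2)) (at t) \<and>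
          (z has_real_derivative x t - l * z t) (at t))"

text \<open>In both cases a global monotone quantity forces x = l z. Then \<open>z\<close> is
  constant and \<open>y\<close> decouples. The points with x = l z, y = 0 are equilibria, so
  constancy is all that can be concluded.\<close>

lemma nilpotent_dynamo_degenerate:
  assumes \<kappa>: "\<kappa> \<noteq> 0" and T: "T > 0" and l: "l = 0 \<or> l = - 1"
    and sol: "solves_nilpotent_dynamo l \<kappa> x y z"
    and per: "\<And>t. x (t + T) = x t" "\<And>t. y (t + T) = y t" "\<And>t. z (t + T) = z t"
  shows "x t = x 0 \<and> y t = y 0 \<and> z t = z 0"
proof -
  have d: "(x has_real_derivative l * (x t - l * z t) + x t * y t) (at t)"
    "(y has_real_derivative - \<kappa> * (y t + (l + 1) * (x t)\<^sup>2)) (at t)"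
    "(z has_real_derivative x t - l * z t) (at t)" for t
    using sol by (auto simp: solves_nilpotent_dynamo_def)
  have y0: "y t = 0" if "\<And>t. (l + 1) * (x t)\<^sup>2 = 0" for t
  proof (rule periodic_exponential_zero[where y = y, OF \<kappa> T per(2)])
    show "(y has_real_derivative - \<kappa> * y t) (at t)" for t
      using d(2)[of t] unfolding that add_0_right .
  qed
  have w0: "x t - l * z t = 0" for t
    using l
  proof
    assume l: "l = 0"
    \<comment> \<open>In the derivative of x^2 exp(c y) the terms with the factor x^2 y then cancel,
      and - 2 x^4 exp(c y) remains.\<close>
    define c where "c = 2 / \<kappa>"
    have c: "c * \<kappa> = 2" using \<kappa> by (simp add: c_def)
    have "c * (- \<kappa> * (y t + (x t)\<^sup>2)) = - (c * \<kappa>) * (y t + (x t)\<^sup>2)" for t by simp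
    then have dy: "((\<lambda>t. c * y t) has_real_derivative - 2 * (y t + (x t)\<^sup>2)) (at t)" for t
      using DERIV_cmult[OF d(2)[of t], of c] l unfolding c by simp
    have "((\<lambda>t. - ((x t)\<^sup>2 * exp (c * y t))) has_real_derivative 2 * x t ^ 4 * exp (c * y t)) (at t)" for t
      by (rule derivative_eq_intros d(1) dy refl)+
         (simp add: l algebra_simps power2_eq_square power4_eq_xxxx)
    then have "2 * x t ^ 4 * exp (c * y t) = 0"
      by (rule periodic_deriv_nonneg_imp_zero[OF T, rotated]) (use per in auto)
    then show "x t - l * z t = 0" using l by simp
  next
    assume l: "l = - 1"
    then have "y t = 0" for t using y0 by simp
    \<comment> \<open>For y = 0 the quantity x - l z is constant, and it is the derivative of
      \<open>z\<close>.\<close>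
    then have "((\<lambda>t. z t * (x t - l * z t)) has_real_derivative (x t - l * z t)\<^sup>2) (at t)" for t
      by (auto intro!: derivative_eq_intros d simp: algebra_simps power2_eq_square)
    then have "(x t - l * z t)\<^sup>2 = 0"
      by (rule periodic_deriv_nonneg_imp_zero[OF T, rotated]) (use per in auto)
    then show "x t - l * z t = 0" by simp
  qed
  have z: "z t = z 0" for t
    using DERIV_isconst_all[of z t 0] d(3) w0 by simp
  have "(l + 1) * (x t)\<^sup>2 = 0" for t using l w0[of t] by auto
  then have "y t = 0" for t by (rule y0)
  moreover have "x t = l * z t" for t using w0[of t] by simp
  ultimately show ?thesis using z by metis
qed

lemma nilpotent_dynamo_no_small_periodic:
  assumes \<kappa>: "\<kappa> \<noteq> 0"
  shows "\<exists>\<epsilon>>0. \<forall>x y z T. T > 0 \<longrightarrow> solves_nilpotent_dynamo l \<kappa> x y z \<longrightarrow>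
    (\<forall>t. x (t + T) = x t \<and> y (t + T) = y t \<and> z (t + T) = z t) \<longrightarrow>
    (\<forall>t. \<bar>x t\<bar> < \<epsilon> \<and> \<bar>y t\<bar> < \<epsilon> \<and> \<bar>z t\<bar> < \<epsilon>) \<longrightarrow> (\<forall>t. x t = x 0 \<and> y t = y 0 \<and> z t = z 0)"
proof (cases "l = 0 \<or> l = - 1")
  case True
  then show ?thesis
    using nilpotent_dynamo_degenerate[OF \<kappa> _ True] by (intro exI[of _ 1] conjI) (simp, blast)
next
  case False
  \<comment> \<open>Rescaling to r x, r (x - l z), y / l gives the normal form with k =
    \<open>\<kappa> / l\<close>; the coefficient (l + 1) / l of x^2 is split into its sign
    \<open>\<sigma>\<close> and the scale r^2.\<close>
  define r where "r = sqrt \<bar>(l + 1) / l\<bar>"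
  define \<sigma> where "\<sigma> = sgn ((l + 1) / l)"
  have l: "l \<noteq> 0" "l + 1 \<noteq> 0" using False by auto
  then have r: "r > 0" by (simp add: r_def)
  have \<sigma>: "\<sigma> = 1 \<or> \<sigma> = - 1" using l by (auto simp: \<sigma>_def sgn_if)
  have "sgn u * (sqrt \<bar>u\<bar>)\<^sup>2 = u" for u :: real by (simp add: sgn_mult_abs)
  then have "\<sigma> * r\<^sup>2 = (l + 1) / l" unfolding \<sigma>_def r_def .
  then have \<sigma>r: "l * (\<sigma> * r\<^sup>2) = l + 1" using l by simp
  have k: "\<kappa> / l \<noteq> 0" using \<kappa> l by simp
  obtain \<epsilon> where \<epsilon>: "\<epsilon> > 0"
    and no: "\<forall>l' x v y T. l' \<noteq> 0 \<longrightarrow> T > 0 \<longrightarrow> solves_normal_form l' (\<kappa> / l) \<sigma> x v y \<longrightarrow>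
      (\<forall>t. x (t + T) = x t \<and> v (t + T) = v t \<and> y (t + T) = y t) \<longrightarrow>
      (\<forall>t. \<bar>x t\<bar> < \<epsilon> \<and> \<bar>v t\<bar> < \<epsilon> \<and> \<bar>y t\<bar> < \<epsilon>) \<longrightarrow> (\<forall>t. x t = 0 \<and> v t = 0 \<and> y t = 0)"
    using normal_form_no_small_periodic[OF k \<sigma>] by (elim exE conjE) (rule that)
  \<comment> \<open>The two entries make the rescaled first two coordinates and the rescaled
    \<open>y\<close>, respectively, smaller than \<open>\<epsilon>\<close>.\<close>
  define \<eta> where "\<eta> = min (\<epsilon> / (r * (1 + \<bar>l\<bar>))) (\<epsilon> * \<bar>l\<bar>)"
  have rl: "r * (1 + \<bar>l\<bar>) > 0" using r by simp
  have \<eta>: "\<eta> > 0" "\<eta> * (r * (1 + \<bar>l\<bar>)) \<le> \<epsilon>" "\<eta> \<le> \<epsilon> * \<bar>l\<bar>"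
  proof -
    show "\<eta> > 0" "\<eta> \<le> \<epsilon> * \<bar>l\<bar>" using \<epsilon> l(1) rl by (simp_all add: \<eta>_def)
    have "\<eta> \<le> \<epsilon> / (r * (1 + \<bar>l\<bar>))" by (simp add: \<eta>_def)
    then show "\<eta> * (r * (1 + \<bar>l\<bar>)) \<le> \<epsilon>" unfolding pos_le_divide_eq[OF rl] .
  qed
  show ?thesis
  proof (intro exI[of _ \<eta>] conjI \<eta>(1) allI impI)
    fix x y z T t
    assume T: "T > (0 :: real)" and sol: "solves_nilpotent_dynamo l \<kappa> x y z"
      and per: "\<forall>t. x (t + T) = x t \<and> y (t + T) = y t \<and> z (t + T) = z t"
      and small: "\<forall>t. \<bar>x t\<bar> < \<eta> \<and> \<bar>y t\<bar> < \<eta> \<and> \<bar>z t\<bar> < \<eta>"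
    have d: "(x has_real_derivative l * (x t - l * z t) + x t * y t) (at t)"
      "(y has_real_derivative - \<kappa> * (y t + (l + 1) * (x t)\<^sup>2)) (at t)"
      "(z has_real_derivative x t - l * z t) (at t)" for t
      using sol by (auto simp: solves_nilpotent_dynamo_def)
    have nf: "solves_normal_form l (\<kappa> / l) \<sigma> (\<lambda>t. r * x t) (\<lambda>t. r * (x t - l * z t)) (\<lambda>t. y t / l)"
      unfolding solves_normal_form_def
    proof (intro allI conjI)
      fix t
      show "((\<lambda>t. r * x t) has_real_derivative
          l * (r * (x t - l * z t) + r * x t * (y t / l))) (at t)"
        using l by (auto intro!: derivative_eq_intros d simp: field_simps)
      show "((\<lambda>t. r * (x t - l * z t)) has_real_derivative l * (r * x t * (y t / l))) (at t)"
        using l by (auto intro!: derivative_eq_intros d simp: field_simps)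
      have "- (l * (\<kappa> / l)) * (y t / l + \<sigma> * (r * x t)\<^sup>2) = - \<kappa> * (y t + l * (\<sigma> * r\<^sup>2) * (x t)\<^sup>2) / l"
        using l by (simp add: field_simps power_mult_distrib)
      then show "((\<lambda>t. y t / l) has_real_derivative
          - (l * (\<kappa> / l)) * (y t / l + \<sigma> * (r * x t)\<^sup>2)) (at t)"
        unfolding \<sigma>r using DERIV_cdivide[OF d(2)[of t], of l] by simp
    qed
    have bounds: "\<bar>r * x t\<bar> < \<epsilon> \<and> \<bar>r * (x t - l * z t)\<bar> < \<epsilon> \<and> \<bar>y t / l\<bar> < \<epsilon>" for t
    proof -
      have s: "\<bar>x t\<bar> < \<eta>" "\<bar>y t\<bar> < \<eta>" "\<bar>z t\<bar> < \<eta>" using small by auto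
      have "\<bar>l * z t\<bar> \<le> \<bar>l\<bar> * \<eta>" unfolding abs_mult using s by (intro mult_left_mono) auto
      then have "\<bar>x t - l * z t\<bar> < \<eta> * (1 + \<bar>l\<bar>)" using s(1) by (simp add: algebra_simps)
      moreover have "\<bar>x t\<bar> < \<eta> * (1 + \<bar>l\<bar>)"
        using less_le_trans[OF s(1), of "\<eta> * (1 + \<bar>l\<bar>)"] \<eta>(1) by (simp add: algebra_simps)
      ultimately have "r * \<bar>x t\<bar> < r * (\<eta> * (1 + \<bar>l\<bar>))" "r * \<bar>x t - l * z t\<bar> < r * (\<eta> * (1 + \<bar>l\<bar>))"
        using r by (auto intro: mult_strict_left_mono)
      moreover have "r * (\<eta> * (1 + \<bar>l\<bar>)) \<le> \<epsilon>" using \<eta>(2) by (simp add: ac_simps)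
      ultimately have "r * \<bar>x t\<bar> < \<epsilon>" "r * \<bar>x t - l * z t\<bar> < \<epsilon>" by linarith+
      moreover have "\<bar>y t / l\<bar> < \<epsilon>" using s(2) \<eta>(3) l by (simp add: abs_divide divide_less_eq)
      ultimately show ?thesis using r by (simp add: abs_mult)
    qed
    have *: "r * x t = 0 \<and> r * (x t - l * z t) = 0 \<and> y t / l = 0" for t
      by (rule no[rule_format, OF l(1) T nf]) (simp add: per, rule bounds)
    have "x t = 0 \<and> y t = 0 \<and> z t = 0" for t
      using *[of t] r l by auto
    then show "x t = x 0" "y t = y 0" "z t = z 0" by simp_all
  qed
qed

section \<open>The vector field: Lipschitz bounds, linear part and parameters\<close>

lemma hsa_field_nth [simp]:
  "hsa_field \<alpha> \<beta> l \<kappa> v $ 1 = - (v $ 1) - \<beta> * v $ 3 + v $ 1 * v $ 2"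
  "hsa_field \<alpha> \<beta> l \<kappa> v $ 2 = \<alpha> - \<kappa> * v $ 2 - \<alpha> * (v $ 1)\<^sup>2"
  "hsa_field \<alpha> \<beta> l \<kappa> v $ 3 = v $ 1 - l * v $ 3"
  by (simp_all add: hsa_field_def Let_def)

lemma hsa_field_has_derivative:
  "(hsa_field \<alpha> \<beta> l \<kappa> has_derivative
     (\<lambda>u. vector [- (u $ 1) - \<beta> * u $ 3 + (u $ 1 * p $ 2 + p $ 1 * u $ 2),
                  - \<kappa> * u $ 2 - 2 * \<alpha> * p $ 1 * u $ 1, u $ 1 - l * u $ 3])) (at p)"
proof -
  have n: "((\<lambda>v :: real^3. v $ i) has_derivative (\<lambda>u. u $ i)) (at p)" for i
    by (rule bounded_linear_imp_has_derivative[OF bounded_linear_vec_nth])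
  show ?thesis
    unfolding hsa_field_def[abs_def] Let_def vector_3_scaleR_axis
    by (rule derivative_eq_intros n refl)+ (simp add: algebra_simps)
qed

lemma hsa_field_lipschitz: "\<exists>L. L-lipschitz_on (cball 0 R) (hsa_field \<alpha> \<beta> l \<kappa>)"
proof -
  define L where "L = (1 + \<bar>\<beta>\<bar> + 2 * \<bar>R\<bar>) + (\<bar>\<kappa>\<bar> + \<bar>\<alpha>\<bar> * (2 * \<bar>R\<bar>)) + (1 + \<bar>l\<bar>)"
  have "L-lipschitz_on (cball 0 R) (hsa_field \<alpha> \<beta> l \<kappa>)"
  proof (rule lipschitz_onI)
    fix u v :: "real^3"
    assume "u \<in> cball 0 R" "v \<in> cball 0 R"
    then have R: "\<bar>u $ i\<bar> \<le> \<bar>R\<bar>" "\<bar>v $ i\<bar> \<le> \<bar>R\<bar>" for i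
      using component_le_norm_cart[of u i] component_le_norm_cart[of v i] by auto
    define d where "d = norm (u - v)"
    have d: "\<bar>u $ i - v $ i\<bar> \<le> d" for i
      using component_le_norm_cart[of "u - v" i] by (simp add: d_def)
    have bd: "\<bar>a * (u $ i - v $ i)\<bar> \<le> b * d" if "\<bar>a\<bar> \<le> b" for a b i
      unfolding abs_mult using that d by (intro mult_mono) auto
    let ?D = "hsa_field \<alpha> \<beta> l \<kappa> u - hsa_field \<alpha> \<beta> l \<kappa> v"
    have "?D $ 1 = (- 1) * (u $ 1 - v $ 1) + (- \<beta>) * (u $ 3 - v $ 3) + u $ 2 * (u $ 1 - v $ 1) + v $ 1 * (u $ 2 - v $ 2)"
      by (simp add: algebra_simps)
    moreover have "\<bar>(- 1) * (u $ 1 - v $ 1)\<bar> \<le> 1 * d" "\<bar>(- \<beta>) * (u $ 3 - v $ 3)\<bar> \<le> \<bar>\<beta>\<bar> * d"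
      "\<bar>u $ 2 * (u $ 1 - v $ 1)\<bar> \<le> \<bar>R\<bar> * d" "\<bar>v $ 1 * (u $ 2 - v $ 2)\<bar> \<le> \<bar>R\<bar> * d"
      using R by (intro bd; simp)+
    ultimately have 1: "\<bar>?D $ 1\<bar> \<le> 1 * d + \<bar>\<beta>\<bar> * d + \<bar>R\<bar> * d + \<bar>R\<bar> * d" by linarith
    have "?D $ 2 = (- \<kappa>) * (u $ 2 - v $ 2) + (- \<alpha> * (u $ 1 + v $ 1)) * (u $ 1 - v $ 1)"
      by (simp add: algebra_simps power2_eq_square)
    moreover have "\<bar>(- \<kappa>) * (u $ 2 - v $ 2)\<bar> \<le> \<bar>\<kappa>\<bar> * d" by (rule bd) simp
    moreover have "\<bar>(- \<alpha> * (u $ 1 + v $ 1)) * (u $ 1 - v $ 1)\<bar> \<le> (\<bar>\<alpha>\<bar> * (2 * \<bar>R\<bar>)) * d"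
    proof (rule bd)
      have "\<bar>u $ 1 + v $ 1\<bar> \<le> 2 * \<bar>R\<bar>" using R(1)[of 1] R(2)[of 1] by linarith
      then show "\<bar>- \<alpha> * (u $ 1 + v $ 1)\<bar> \<le> \<bar>\<alpha>\<bar> * (2 * \<bar>R\<bar>)"
        by (simp add: abs_mult mult_left_mono)
    qed
    ultimately have 2: "\<bar>?D $ 2\<bar> \<le> \<bar>\<kappa>\<bar> * d + (\<bar>\<alpha>\<bar> * (2 * \<bar>R\<bar>)) * d" by linarith
    have "?D $ 3 = 1 * (u $ 1 - v $ 1) + (- l) * (u $ 3 - v $ 3)"
      by (simp add: algebra_simps)
    moreover have "\<bar>1 * (u $ 1 - v $ 1)\<bar> \<le> 1 * d" "\<bar>(- l) * (u $ 3 - v $ 3)\<bar> \<le> \<bar>l\<bar> * d"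
      by (intro bd; simp)+
    ultimately have 3: "\<bar>?D $ 3\<bar> \<le> 1 * d + \<bar>l\<bar> * d" by linarith
    have "norm ?D \<le> \<bar>?D $ 1\<bar> + \<bar>?D $ 2\<bar> + \<bar>?D $ 3\<bar>"
      using norm_le_l1_cart[of ?D] by (simp add: sum_3)
    also have "\<dots> \<le> L * d"
      using 1 2 3 by (simp add: L_def algebra_simps)
    finally show "dist (hsa_field \<alpha> \<beta> l \<kappa> u) (hsa_field \<alpha> \<beta> l \<kappa> v) \<le> L * dist u v"
      by (simp add: dist_norm d_def)
  qed (simp add: L_def)
  then show ?thesis ..
qed

lemma field_in_coords_lipschitz:
  assumes F: "\<And>R. \<exists>L. L-lipschitz_on (cball 0 R) F"
  shows "\<exists>L. L-lipschitz_on (cball 0 R) (field_in_coords F p A)"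
proof -
  obtain K where K: "K > 0" "\<And>x. norm (A *v x) \<le> norm x * K"
    using bounded_linear.pos_bounded[OF matrix_vector_mul_bounded_linear[of A]] by blast
  obtain K' where K': "K' > 0" "\<And>x. norm (matrix_inv A *v x) \<le> norm x * K'"
    using bounded_linear.pos_bounded[OF matrix_vector_mul_bounded_linear[of "matrix_inv A"]] by blast
  \<comment> \<open>The affine change of coordinates maps the ball of radius \<open>R\<close> into
    this larger ball.\<close>
  obtain L where L: "L-lipschitz_on (cball 0 (norm p + R * K)) F" using F by blast
  have L0: "L \<ge> 0" by (rule lipschitz_on_nonneg[OF L])
  have "(L * K * K')-lipschitz_on (cball 0 R) (field_in_coords F p A)"
  proof (rule lipschitz_onI)
    fix u v :: "real^3"
    assume uv: "u \<in> cball 0 R" "v \<in> cball 0 R"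
    have mem: "p + A *v x \<in> cball 0 (norm p + R * K)" if "x \<in> cball 0 R" for x
    proof -
      have "norm x * K \<le> R * K" using that K(1) by (intro mult_right_mono) auto
      then show ?thesis using norm_triangle_ineq[of p "A *v x"] K(2)[of x] by simp
    qed
    have "dist (F (p + A *v u)) (F (p + A *v v)) \<le> L * dist (p + A *v u) (p + A *v v)"
      by (rule lipschitz_onD[OF L mem[OF uv(1)] mem[OF uv(2)]])
    also have "\<dots> = L * norm (A *v (u - v))"
      by (simp add: dist_norm matrix_vector_mult_diff_distrib)
    also have "\<dots> \<le> L * (norm (u - v) * K)" by (intro mult_left_mono K L0)
    finally have F: "norm (F (p + A *v u) - F (p + A *v v)) \<le> L * (norm (u - v) * K)"
      by (simp add: dist_norm)
    have "dist (field_in_coords F p A u) (field_in_coords F p A v)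
        = norm (matrix_inv A *v (F (p + A *v u) - F (p + A *v v)))"
      by (simp add: field_in_coords_def dist_norm matrix_vector_mult_diff_distrib)
    also have "\<dots> \<le> norm (F (p + A *v u) - F (p + A *v v)) * K'" by (rule K')
    also have "\<dots> \<le> (L * (norm (u - v) * K)) * K'" using F K' by (intro mult_right_mono) auto
    finally show "dist (field_in_coords F p A u) (field_in_coords F p A v) \<le> L * K * K' * dist u v"
      by (simp add: dist_norm ac_simps)
  qed (use L0 K K' in simp)
  then show ?thesis ..
qed

lemma matrix_inv_mult_vector:
  fixes A :: "real^'n^'n"
  assumes "invertible A"
  shows "A *v (matrix_inv A *v x) = x" "matrix_inv A *v (A *v x) = x"
proof -
  have "A ** matrix_inv A = mat 1 \<and> matrix_inv A ** A = mat 1"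
    using assms unfolding invertible_def matrix_inv_def by (rule someI_ex)
  then show "A *v (matrix_inv A *v x) = x" "matrix_inv A *v (A *v x) = x"
    by (simp_all add: matrix_vector_mul_assoc)
qed

text \<open>The first two columns of \<open>A\<close> form a Jordan chain of the linear part for the
  eigenvalue 0. As \<open>\<kappa> \<noteq> 0\<close>, their second entries vanish, which leaves a
  chain of length two in the x and z components.\<close>

lemma hsa_nilpotent_parameters:
  assumes \<kappa>: "\<kappa> \<noteq> 0"
    and nil: "nilpotent_coords (hsa_field \<alpha> \<beta> l \<kappa>) (vector [0, \<alpha> / \<kappa>, 0]) A"
  shows "\<beta> = l\<^sup>2" "\<alpha> = \<kappa> * (l + 1)"
proof -
  define p :: "real^3" where "p = vector [0, \<alpha> / \<kappa>, 0]"
  define c where "c = \<alpha> / \<kappa>"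
  have p: "p $ 1 = 0" "p $ 2 = c" by (simp_all add: p_def c_def)
  let ?F = "hsa_field \<alpha> \<beta> l \<kappa>"
  define D where "D u = (vector [- (u $ 1) - \<beta> * u $ 3 + c * u $ 1, - \<kappa> * u $ 2, u $ 1 - l * u $ 3] :: real^3)"
    for u :: "real^3"
  obtain \<nu> where inv: "invertible A"
    and der: "(field_in_coords ?F p A has_derivative (\<lambda>w. vector [w$2, 0, - \<nu> * w$3])) (at 0)"
    using nil unfolding nilpotent_coords_def p_def by blast
  have "(?F has_derivative D) (at (p + A *v 0))"
    using hsa_field_has_derivative[of \<alpha> \<beta> l \<kappa> p] unfolding D_def[abs_def] by (simp add: p mult.commute)
  moreover have "((\<lambda>w. p + A *v w) has_derivative (\<lambda>u. A *v u)) (at 0)"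
    using has_derivative_add[OF has_derivative_const
        bounded_linear_imp_has_derivative[OF matrix_vector_mul_bounded_linear[of A]]] by simp
  ultimately have "((\<lambda>w. ?F (p + A *v w)) has_derivative (\<lambda>u. D (A *v u))) (at 0)"
    using has_derivative_compose[of "\<lambda>w. p + A *v w" _ 0 UNIV ?F D] by simp
  then have "(field_in_coords ?F p A has_derivative (\<lambda>u. matrix_inv A *v D (A *v u))) (at 0)"
    unfolding field_in_coords_def[abs_def]
    by (rule bounded_linear.has_derivative[OF matrix_vector_mul_bounded_linear])
  from has_derivative_unique[OF this der]
  have "matrix_inv A *v D (A *v u) = vector [u$2, 0, - \<nu> * u$3]" for u
    by (rule fun_cong)
  then have eq: "D (A *v u) = A *v vector [u$2, 0, - \<nu> * u$3]" for u
    by (metis matrix_inv_mult_vector(1)[OF inv])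
  have "D (A *v axis 1 1) = 0" "D (A *v axis 2 1) = A *v axis 1 1"
  proof -
    have "(vector [0, 0, 0] :: real^3) = 0" "(vector [1, 0, 0] :: real^3) = axis 1 1"
      by (simp_all add: vec_eq_iff forall_3 axis_def)
    then show "D (A *v axis 1 1) = 0" "D (A *v axis 2 1) = A *v axis 1 1"
      unfolding eq by (simp_all add: axis_def)
  qed
  then have "D (column 1 A) = 0" "D (column 2 A) = column 1 A"
    by (simp_all add: matrix_vector_mult_basis)
  then have "D (column 1 A) $ i = 0" "D (column 2 A) $ i = column 1 A $ i" for i by simp_all
  from this(1)[of 1] this(1)[of 2] this(1)[of 3] this(2)[of 1] this(2)[of 2] this(2)[of 3]
  have e: "- (A$1$1) - \<beta> * A$3$1 + c * A$1$1 = 0" "- \<kappa> * A$2$1 = 0" "A$1$1 - l * A$3$1 = 0"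
     "- (A$1$2) - \<beta> * A$3$2 + c * A$1$2 = A$1$1" "- \<kappa> * A$2$2 = A$2$1" "A$1$2 - l * A$3$2 = A$3$1"
    unfolding D_def column_def vector_3 vec_lambda_beta .
  then have A2: "A$2$1 = 0" "A$2$2 = 0" using \<kappa> by auto
  \<comment> \<open>Otherwise the first column of \<open>A\<close> would be zero.\<close>
  have "A$3$1 \<noteq> 0"
  proof
    assume "A$3$1 = 0"
    then have "det A = 0" using A2 e(3) by (simp add: det_3)
    then show False using inv by (simp add: invertible_det_nz)
  qed
  \<comment> \<open>The kernel equations give \<open>\<beta>\<close>; the equations for the second
    column then give \<open>c\<close>.\<close>
  have "((c - 1) * l - \<beta>) * A$3$1 = 0" using e(1,3) by algebra
  then have \<beta>: "\<beta> = (c - 1) * l" using \<open>A$3$1 \<noteq> 0\<close> by simp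
  have "(c - 1 - l) * A$3$1 = 0" using e(3,4,6) \<beta> by algebra
  then have c: "c = l + 1" using \<open>A$3$1 \<noteq> 0\<close> by simp
  show "\<beta> = l\<^sup>2" using \<beta> c by (simp add: power2_eq_square)
  show "\<alpha> = \<kappa> * (l + 1)" using c \<kappa> by (simp add: c_def field_simps)
qed

theorem theorem40:
  fixes \<alpha> \<beta> l \<kappa> :: real and r :: nat
  assumes "\<kappa> \<noteq> 0" and "r \<ge> 1"
  shows "\<not> nilpotent_center_on_center_manifold r (hsa_field \<alpha> \<beta> l \<kappa>) (vector [0, \<alpha> / \<kappa>, 0])"
proof
  let ?F = "hsa_field \<alpha> \<beta> l \<kappa>"
  define p :: "real^3" where "p = vector [0, \<alpha> / \<kappa>, 0]"
  assume "nilpotent_center_on_center_manifold r ?F (vector [0, \<alpha> / \<kappa>, 0])"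
  then obtain A h U where nil: "nilpotent_coords ?F p A"
    and cm: "center_manifold r (field_in_coords ?F p A) h U"
    and pc: "planar_center (restricted_field (field_in_coords ?F p A) h) U"
    unfolding nilpotent_center_on_center_manifold_def p_def[symmetric] by (elim exE conjE) (rule that)
  let ?G = "field_in_coords ?F p A"
  have par: "\<beta> = l\<^sup>2" "\<alpha> = \<kappa> * (l + 1)"
    using hsa_nilpotent_parameters[OF assms(1) nil[unfolded p_def]] by auto
  have p: "p $ 1 = 0" "p $ 2 = l + 1" "p $ 3 = 0" using par assms(1) by (simp_all add: p_def)
  have inv: "invertible A" and "?F p = 0" using nil by (simp_all add: nilpotent_coords_def)
  then have G0: "?G 0 = 0" by (simp add: field_in_coords_def)
  obtain \<epsilon> where \<epsilon>: "\<epsilon> > 0"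
    and no: "\<forall>x y z T. T > 0 \<longrightarrow> solves_nilpotent_dynamo l \<kappa> x y z \<longrightarrow>
    (\<forall>t. x (t + T) = x t \<and> y (t + T) = y t \<and> z (t + T) = z t) \<longrightarrow>
    (\<forall>t. \<bar>x t\<bar> < \<epsilon> \<and> \<bar>y t\<bar> < \<epsilon> \<and> \<bar>z t\<bar> < \<epsilon>) \<longrightarrow> (\<forall>t. x t = x 0 \<and> y t = y 0 \<and> z t = z 0)"
    using nilpotent_dynamo_no_small_periodic[OF assms(1), of l] by (elim exE conjE) (rule that)
  obtain K where K: "K > 0" "\<And>x. norm (A *v x) \<le> norm x * K"
    using bounded_linear.pos_bounded[OF matrix_vector_mul_bounded_linear[of A]] by blast
  \<comment> \<open>The radius \<open>\<epsilon> / K\<close> ensures that \<open>A\<close> maps the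
    orbit into the ball of radius \<open>\<epsilon>\<close>.\<close>
  obtain w where w: "periodic_solution ?G w" "range w \<subseteq> ball 0 (\<epsilon> / K)"
    using center_manifold_small_periodic[OF cm assms(2) G0
        field_in_coords_lipschitz[OF hsa_field_lipschitz] pc, of "\<epsilon> / K"] \<epsilon> K(1) by auto
  \<comment> \<open>This is the displacement from the singular point in the original
    coordinates.\<close>
  define u where "u t = A *v w t" for t
  have u_small: "\<bar>u t $ i\<bar> < \<epsilon>" for t i
  proof -
    have "w t \<in> ball 0 (\<epsilon> / K)" using w(2) by blast
    then have "norm (w t) < \<epsilon> / K" by simp
    then have "norm (w t) * K < \<epsilon>" using K(1) by (simp add: pos_less_divide_eq)
    then show ?thesis
      using K(2)[of "w t"] component_le_norm_cart[of "u t" i] by (simp add: u_def)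
  qed
  have u_deriv: "(u has_vector_derivative ?F (p + u t)) (at t)" for t
  proof -
    have "(w has_vector_derivative ?G (w t)) (at t)"
      using w(1) by (simp add: periodic_solution_def solution_on_def)
    from bounded_linear.has_vector_derivative[OF matrix_vector_mul_bounded_linear[of A] this]
    show ?thesis
      by (simp add: u_def[abs_def] field_in_coords_def matrix_inv_mult_vector[OF inv])
  qed
  have comp: "((\<lambda>t. u t $ i) has_real_derivative ?F (p + u t) $ i) (at t)" for t i
    using has_vector_derivative_nth[OF u_deriv]
    by (simp add: has_real_derivative_iff_has_vector_derivative)
  have sol: "solves_nilpotent_dynamo l \<kappa> (\<lambda>t. u t $ 1) (\<lambda>t. u t $ 2) (\<lambda>t. u t $ 3)"
    unfolding solves_nilpotent_dynamo_def
  proof (intro allI conjI)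
    fix t
    show "((\<lambda>t. u t $ 1) has_real_derivative l * (u t $ 1 - l * u t $ 3) + u t $ 1 * u t $ 2) (at t)"
      using comp[of 1 t] by (simp add: p par power2_eq_square algebra_simps)
    show "((\<lambda>t. u t $ 2) has_real_derivative - \<kappa> * (u t $ 2 + (l + 1) * (u t $ 1)\<^sup>2)) (at t)"
      using comp[of 2 t] by (simp add: p par algebra_simps)
    show "((\<lambda>t. u t $ 3) has_real_derivative u t $ 1 - l * u t $ 3) (at t)"
      using comp[of 3 t] by (simp add: p)
  qed
  obtain T where T: "T > 0" "\<And>t. w (t + T) = w t" using w(1) by (auto simp: periodic_solution_def)
  have "u t $ 1 = u 0 $ 1 \<and> u t $ 2 = u 0 $ 2 \<and> u t $ 3 = u 0 $ 3" for t
    by (rule no[rule_format, OF T(1) sol]) (simp_all add: u_def T(2) u_small[unfolded u_def])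
  then have "A *v w t = A *v w 0" for t by (simp add: u_def vec_eq_iff forall_3)
  then have "w t = w 0" for t
    by (metis matrix_inv_mult_vector(2)[OF inv])
  then show False using w(1) by (auto simp: periodic_solution_def constant_on_def)
qed

end
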